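(* Let $\varepsilon,\sigma>0$, let $a<b$ be real, and let $n\in\mathbb{Z}$ with $n\ge O(\log((b-a)/\sigma)/\varepsilon)$. There exists a $\frac12\varepsilon^2$-CDP algorithm $M:\mathbb{R}^n\to\mathbb{R}$ such that the following holds. Let $\mathcal{D}$ be a $\sigma$-subgaussian distribution on $\mathbb{R}$ that is symmetric about its mean $\mu\in[a,b]$. Then $$\mathbb{E}_{X\leftarrow\mathcal{D}^n}\left[(M(X)-\mu)^2\right]\le\frac{\sigma^2}{n}+\frac{\sigma^2}{n^2}\cdot O\left(\frac{\log((b-a)/\sigma)}{\varepsilon}+\frac{\log n}{\varepsilon^2}\right),$$ where the expectation is over both the i.i.d. sample $X$ and the internal randomness of $M$.
   Context: $O(\cdot)$ hides universal constants; "$n\ge O(g)$" means that $n$ is at least a suitable universal constant times $g$. The algorithm $M$ does not depend on $\mathcal{D}$ (it may depend on $\varepsilon,\sigma,a,b,n$). A distribution $\mathcal{D}$ on $\mathbb{R}$ is $\sigma$-subgaussian if there is $\mu\in\mathbb{R}$ with $\mathbb{E}_{X\leftarrow\mathcal{D}}[e^{u(X-\mu)}]\le e^{u^2\sigma^2/2}$ for all $u\in\mathbb{R}$. $X\leftarrow\mathcal{D}^n$ means $n$ i.i.d. samples from $\mathcal{D}$. A randomized algorithm $M:\mathbb{R}^n\to\mathbb{R}$ assigns to each $x\in\mathbb{R}^n$ a real random variable $M(x)$. For $\alpha\in(1,\infty)$, $D_\alpha(P\|Q)=\frac{1}{\alpha-1}\log\mathbb{E}_{X\leftarrow P}\left[(P(X)/Q(X))^{\alpha-1}\right]$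 is the Rényi divergence of order $\alpha$ (ratio of densities, $+\infty$ if $P$ is not absolutely continuous with respect to $Q$). $M$ is $\frac12\varepsilon^2$-CDP (concentrated differentially private) if $D_\alpha(M(x)\|M(y))\le\frac12\varepsilon^2\alpha$ for all $x,y\in\mathbb{R}^n$ differing in at most one entry and all $\alpha\in(1,\infty)$.
   Formalization: The logarithm of (b-a)/σ is replaced by its positive part, both in the condition on n and in the error bound (for b-a much smaller than σ the literal bound would be negative, hence false), and n is taken to be at least 1. *)

theory Defs
  imports "HOL-Probability.Probability"
begin

(* The moment generating function is a nonnegative integral, so the bound also says that it is
   finite; a Bochner integral would be 0 for a non-integrable integrand. *)
definition subgaussian :: "real \<Rightarrow> real measure \<Rightarrow> bool" where
  "subgaussian \<sigma> D \<longleftrightarrow>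
     (\<exists>m. \<forall>u. (\<integral>\<^sup>+x. ennreal (exp (u * (x - m))) \<partial>D) \<le> ennreal (exp (u\<^sup>2 * \<sigma>\<^sup>2 / 2)))"

definition symmetric_about :: "real measure \<Rightarrow> real \<Rightarrow> bool" where
  "symmetric_about D m \<longleftrightarrow> distr D borel (\<lambda>x. m + (m - x)) = distr D borel (\<lambda>x. x)"

(* R^n as functions on {..<n} (undefined elsewhere); the dimension has to be a term because
   it is quantified inside the universal constants. *)
abbreviation real_vec :: "nat \<Rightarrow> (nat \<Rightarrow> real) measure" where
  "real_vec n \<equiv> Pi\<^sub>M {..<n} (\<lambda>_. borel)"

(* M x is the law of the output on input x. Measurability in x (a Markov kernel) is what makes
   the expectation over both the sample and the internal randomness well defined. *)
definition randomized_algorithm :: "nat \<Rightarrow> ((nat \<Rightarrow> real) \<Rightarrow> real measure) \<Rightarrow> bool" where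
  "randomized_algorithm n M \<longleftrightarrow> M \<in> real_vec n \<rightarrow>\<^sub>M prob_algebra borel"

(* Meant for probability measures P, Q on the same measurable space and \<alpha> > 1.
   P(x)/Q(x) is the density RN_deriv Q P of P with respect to Q; it is finite Q-almost everywhere,
   hence P-almost everywhere, so that enn2real loses nothing. *)
definition renyi_divergence :: "real \<Rightarrow> 'a measure \<Rightarrow> 'a measure \<Rightarrow> ereal" where
  "renyi_divergence \<alpha> P Q =
     (let I = (\<integral>\<^sup>+x. ennreal (enn2real (RN_deriv Q P x) powr (\<alpha> - 1)) \<partial>P)
      in if absolutely_continuous Q P \<and> I < \<infinity>
         then ereal (1 / (\<alpha> - 1) * ln (enn2real I)) else \<infinity>)"

definition concentrated_DP :: "nat \<Rightarrow> real \<Rightarrow> ((nat \<Rightarrow> real) \<Rightarrow> real measure) \<Rightarrow> bool" where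
  "concentrated_DP n \<rho> M \<longleftrightarrow>
     (\<forall>x \<in> space (real_vec n). \<forall>y \<in> space (real_vec n). card {i \<in> {..<n}. x i \<noteq> y i} \<le> 1 \<longrightarrow>
        (\<forall>\<alpha>>1. renyi_divergence \<alpha> (M x) (M y) \<le> ereal (\<rho> * \<alpha>)))"

(* The logarithm of the ratio (b - a) / \<sigma> truncated at 0, as usual for a quantity under an O.
   It is ln ((b - a) / \<sigma>) whenever b - a \<ge> \<sigma>. For b - a < \<sigma> the plain logarithm is negative and
   tends to minus infinity as b - a tends to 0, so that it cannot appear in an upper bound on a
   mean squared error. *)
definition log_ratio :: "real \<Rightarrow> real \<Rightarrow> real \<Rightarrow> real" where
  "log_ratio a b \<sigma> = max 0 (ln ((b - a) / \<sigma>))"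

end

theory Submission
  imports Defs
begin

text \<open>The estimator first locates the mean coarsely, then averages the data clamped to a window around
that location, and adds Gaussian noise. Both steps are done at once: on input \<open>x\<close> the output law is
a finite mixture of Gaussians with centres \<open>f x g\<close>, one for each point \<open>g\<close> of a grid, and the weight
of the component \<open>g\<close> is proportional to \<open>exp (\<epsilon> / 8 * q x g)\<close> for a score \<open>q x g\<close> that changes by at
most one between neighbouring inputs (the exponential mechanism).

\<^emph>\<open>Privacy.\<close> By convexity of \<open>t \<mapsto> t powr \<alpha>\<close>, forgetting which component was drawn does not increase
the Renyi integral. Before forgetting, this integral is a sum of products: the contribution of the
weights is controlled by \<open>exp_weight_renyi\<close>, and that of the Gaussians is an explicit integral which
depends only on the ratio of the sensitivity of \<open>f\<close> to the standard deviation. The two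
contributions add up to at most \<open>\<epsilon>\<^sup>2 / 2\<close> per unit of \<open>\<alpha>\<close>
(\<open>renyi_divergence_gaussian_mixture\<close>, \<open>concentrated_DP_gaussian_mixture\<close>).

\<^emph>\<open>Accuracy.\<close> Write \<open>U = ln n + 1 + \<epsilon>\<close> and \<open>t = 8 * sqrt U\<close>. The grid has spacing \<open>\<sigma>\<close>, the score of a
grid point is the number of samples within \<open>(t + 1) * \<sigma>\<close> of it, and \<open>f\<close> clamps every sample to within
\<open>(3 * t + 1) * \<sigma>\<close> of the grid point before averaging. If all samples are within \<open>t * \<sigma>\<close> of \<open>\<mu>\<close>, then at
every grid point near \<open>\<mu>\<close> the clamping does nothing, so that \<open>f\<close> is the plain sample mean, whose
mean squared error is at most \<open>\<sigma>\<^sup>2 / n\<close>. If some samples are far away but at least three quarters are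
not, then the grid points near \<open>\<mu>\<close> still beat all remote ones by \<open>n / 2\<close> counts, a remote point is
selected with probability exponentially small in \<open>n * \<epsilon>\<close>, and the error at the near points is
\<open>O(t * \<sigma>)\<close>; this happens with probability polynomially small in \<open>n\<close> and exponentially small in \<open>\<epsilon>\<close>.
More than a quarter of the samples are far away only with probability exponentially small in
\<open>n * \<epsilon>\<close>, because \<open>t\<^sup>2\<close> is at least of order \<open>\<epsilon>\<close>. The hypothesis on \<open>n\<close> lets \<open>exp (- c * n * \<epsilon>)\<close> absorb every
power of \<open>(b - a) / \<sigma>\<close> that occurs. What remains is the noise variance, \<open>O(U * \<sigma>\<^sup>2 / (n * \<epsilon>)\<^sup>2)\<close>.

\<^emph>\<open>Regimes.\<close> This is within the target unless \<open>b - a\<close> is at most of order \<open>\<sigma>\<close> and \<open>\<epsilon>\<close> is much larger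
than \<open>ln n\<close>. Then, for \<open>n > 1\<close>, the selection is made on a grid of spacing \<open>\<sigma> / n\<close> and
locates the sample mean truncated to \<open>[a, b]\<close>, which is clamped around the selected point. The noise
has standard deviation \<open>O(\<sigma> / (n * \<epsilon>))\<close>, and the selection fails with probability at most
\<open>O(n) * exp (- (\<epsilon> / 8))\<close>. For \<open>n = 1\<close> the
target is just \<open>\<sigma>\<^sup>2\<close> when \<open>b = a + \<sigma>\<close>, and a slightly blurred midpoint of \<open>[a, b]\<close> attains it.

All deviation events enter through pointwise Chernoff majorants (\<open>tail_bound\<close>), so that the error is
bounded by a sum and a product over the samples, which integrate in closed form
(\<open>expected_error_gaussian_mixture\<close>).\<close>

section \<open>Exponential weights\<close>

text \<open>The output distribution of the exponential mechanism on \<open>{..<K}\<close> with score \<open>q\<close>.\<close>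
definition exp_weight :: "nat \<Rightarrow> real \<Rightarrow> (nat \<Rightarrow> real) \<Rightarrow> nat \<Rightarrow> real" where
  "exp_weight K \<eta> q g = exp (\<eta> * q g) / (\<Sum>j<K. exp (\<eta> * q j))"

lemma sum_exp_pos: "K > 0 \<Longrightarrow> 0 < (\<Sum>j<(K::nat). exp (u j :: real))"
  by (rule sum_pos) (auto simp: lessThan_empty_iff)

lemma exp_weight_pos: "K > 0 \<Longrightarrow> 0 < exp_weight K \<eta> q g"
  unfolding exp_weight_def by (intro divide_pos_pos sum_exp_pos) auto

lemma sum_exp_weight: "K > 0 \<Longrightarrow> (\<Sum>g<K. exp_weight K \<eta> q g) = 1"
  using sum_exp_pos[of K "\<lambda>j. \<eta> * q j"] by (simp add: exp_weight_def flip: sum_divide_distrib)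

text \<open>A single competitor \<open>j\<close> with a score higher by \<open>d\<close> already occurs in the normalising sum.\<close>
lemma exp_weight_le_gap:
  assumes "j < K" "q g + d \<le> q j" "0 \<le> \<eta>"
  shows "exp_weight K \<eta> q g \<le> exp (- (\<eta> * d))"
proof -
  have "exp (\<eta> * q g) * exp (\<eta> * d) = exp (\<eta> * (q g + d))"
    by (simp add: exp_add algebra_simps)
  also have "\<dots> \<le> exp (\<eta> * q j)"
    using assms by (simp add: mult_left_mono)
  also have "\<dots> \<le> (\<Sum>i<K. exp (\<eta> * q i))"
    using assms(1) by (intro member_le_sum) auto
  finally show ?thesis
    using assms(1) sum_exp_pos[of K "\<lambda>j. \<eta> * q j"]
    by (simp add: exp_weight_def exp_minus field_simps)
qed

text \<open>Utility of the exponential mechanism: the points outside \<open>Good\<close> are all beaten by \<open>j\<close>, and a union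
bound over at most \<open>K\<close> of them limits their share in the expectation of \<open>v\<close>.\<close>
lemma weighted_sum_le_gap:
  assumes j: "j < K" and gap: "\<And>g. g < K \<Longrightarrow> g \<notin> Good \<Longrightarrow> q g + d \<le> q j" and "0 \<le> \<eta>"
    and good: "\<And>g. g < K \<Longrightarrow> g \<in> Good \<Longrightarrow> v g \<le> A" and "0 \<le> A"
    and bad: "\<And>g. g < K \<Longrightarrow> g \<notin> Good \<Longrightarrow> v g \<le> B" and "0 \<le> B"
  shows "(\<Sum>g<K. exp_weight K \<eta> q g * v g) \<le> A + B * (real K * exp (- (\<eta> * d)))"
proof -
  have K: "K > 0" using j by simp
  have "(\<Sum>g<K. exp_weight K \<eta> q g * v g) \<le> (\<Sum>g<K. exp_weight K \<eta> q g * A + exp (- (\<eta> * d)) * B)"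
  proof (intro sum_mono)
    fix g assume "g \<in> {..<K}"
    hence g: "g < K" by simp
    have p: "0 \<le> exp_weight K \<eta> q g" using exp_weight_pos[OF K] less_imp_le by blast
    show "exp_weight K \<eta> q g * v g \<le> exp_weight K \<eta> q g * A + exp (- (\<eta> * d)) * B"
    proof (cases "g \<in> Good")
      case True
      have "exp_weight K \<eta> q g * v g \<le> exp_weight K \<eta> q g * A"
        using good[OF g True] p by (rule mult_left_mono)
      moreover have "0 \<le> exp (- (\<eta> * d)) * B" using \<open>0 \<le> B\<close> by simp
      ultimately show ?thesis by linarith
    next
      case False
      have "exp_weight K \<eta> q g * v g \<le> exp_weight K \<eta> q g * B"
        using bad[OF g False] p by (rule mult_left_mono)
      also have "\<dots> \<le> exp (- (\<eta> * d)) * B"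
        using exp_weight_le_gap[where \<eta>=\<eta>, OF j gap[OF g False] \<open>0 \<le> \<eta>\<close>] \<open>0 \<le> B\<close>
        by (intro mult_right_mono)
      finally show ?thesis using p \<open>0 \<le> A\<close> by (simp add: add_increasing)
    qed
  qed
  also have "\<dots> = A + B * (real K * exp (- (\<eta> * d)))"
    using sum_exp_weight[OF K, of \<eta> q]
    by (simp add: sum.distrib flip: sum_distrib_right)
  finally show ?thesis .
qed

lemma cosh_le_exp_square: "cosh (x::real) \<le> exp (x\<^sup>2)"
proof -
  have "cosh y \<le> exp (y\<^sup>2)" if y: "0 \<le> y" for y :: real
  proof (cases "y \<le> 1")
    case True
    have "exp y \<le> 1 + y + y\<^sup>2" using exp_bound y True by blast
    moreover have "exp (- y) \<le> 1 - y + y\<^sup>2"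
    proof -
      have "exp (- y) * (1 + y) \<le> exp (- y) * exp y" by (intro mult_left_mono) auto
      hence "exp (- y) * (1 + y) \<le> 1" by (simp flip: exp_add)
      also have "1 \<le> (1 - y + y\<^sup>2) * (1 + y)"
        using y by (simp add: algebra_simps power2_eq_square)
      finally show ?thesis using y by (simp add: mult_le_cancel_right)
    qed
    ultimately have "cosh y \<le> 1 + y\<^sup>2" by (simp add: cosh_def)
    thus ?thesis using exp_ge_add_one_self[of "y\<^sup>2"] by linarith
  next
    case False
    have "exp (- y) \<le> exp y" using y by simp
    hence "cosh y \<le> exp y" by (simp add: cosh_def)
    also have "\<dots> \<le> exp (y\<^sup>2)" using False by (simp add: power2_eq_square)
    finally show ?thesis .
  qed
  from this[of "\<bar>x\<bar>"] show ?thesis by (cases "x \<ge> 0") auto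
qed

text \<open>Under the weights \<open>w\<close>, the left-hand side is \<open>E exp (a * d) / (E exp d) powr a\<close>. Two applications of
Jensen's inequality for \<open>exp\<close> replace the denominator by the factor \<open>E exp (- a * d)\<close>. The resulting
product is a double sum over an independent copy, which is symmetric, so that only \<open>cosh\<close> of
\<open>a * (d i - d j)\<close> survives and the exponent becomes quadratic.\<close>
lemma exp_moment_ratio_le:
  fixes w d :: "'i \<Rightarrow> real"
  assumes fin: "finite I" and ne: "I \<noteq> {}" and w: "\<And>i. i \<in> I \<Longrightarrow> 0 \<le> w i" and w1: "sum w I = 1"
    and d: "\<And>i. i \<in> I \<Longrightarrow> \<bar>d i\<bar> \<le> c" and "0 \<le> a"
  shows "(\<Sum>i\<in>I. w i * exp (a * d i)) * (\<Sum>i\<in>I. w i * exp (d i)) powr (- a) \<le> exp (4 * a\<^sup>2 * c\<^sup>2)"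
proof -
  define m where "m = (\<Sum>i\<in>I. w i * d i)"
  have jensen: "exp (b * m) \<le> (\<Sum>i\<in>I. w i * exp (b * d i))" for b
    using convex_on_sum[OF fin ne exp_convex w1 w, of "\<lambda>i. b * d i"]
    by (simp add: m_def sum_distrib_left algebra_simps)
  have "(\<Sum>i\<in>I. w i * exp (d i)) powr (- a) \<le> exp m powr (- a)"
    using jensen[of 1] \<open>0 \<le> a\<close> by (intro powr_mono2') auto
  also have "\<dots> = exp (- a * m)" by (simp add: powr_def)
  also have "\<dots> \<le> (\<Sum>i\<in>I. w i * exp (- a * d i))" by (rule jensen)
  finally have "(\<Sum>i\<in>I. w i * exp (a * d i)) * (\<Sum>i\<in>I. w i * exp (d i)) powr (- a)
      \<le> (\<Sum>i\<in>I. w i * exp (a * d i)) * (\<Sum>i\<in>I. w i * exp (- a * d i))"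
    by (intro mult_left_mono sum_nonneg) (auto simp: w)
  also have "\<dots> = (\<Sum>i\<in>I. \<Sum>j\<in>I. w i * w j * exp (a * (d i - d j)))"
    by (simp add: sum_product exp_add exp_diff right_diff_distrib exp_minus field_simps)
  also have "\<dots> = (\<Sum>i\<in>I. \<Sum>j\<in>I. w i * w j * cosh (a * (d i - d j)))" (is "?S = _")
  proof -
    have "?S = (\<Sum>i\<in>I. \<Sum>j\<in>I. w i * w j * exp (a * (d j - d i)))"
      by (subst sum.swap) (simp add: mult.commute)
    hence "?S = ((\<Sum>i\<in>I. \<Sum>j\<in>I. w i * w j * exp (a * (d i - d j)))
        + (\<Sum>i\<in>I. \<Sum>j\<in>I. w i * w j * exp (a * (d j - d i)))) / 2" by simp
    also have "\<dots> = (\<Sum>i\<in>I. \<Sum>j\<in>I. w i * w j * cosh (a * (d i - d j)))"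
      by (simp add: cosh_def sum_divide_distrib flip: sum.distrib)
         (simp add: field_simps)
    finally show ?thesis .
  qed
  also have "\<dots> \<le> (\<Sum>i\<in>I. \<Sum>j\<in>I. w i * w j * exp (4 * a\<^sup>2 * c\<^sup>2))"
  proof (intro sum_mono mult_left_mono)
    fix i j assume ij: "i \<in> I" "j \<in> I"
    have "\<bar>d i - d j\<bar> \<le> 2 * c" using d[OF ij(1)] d[OF ij(2)] by linarith
    hence "(d i - d j)\<^sup>2 \<le> (2 * c)\<^sup>2" by (metis abs_le_square_iff abs_of_nonneg abs_ge_zero order_trans)
    hence "(a * (d i - d j))\<^sup>2 \<le> 4 * a\<^sup>2 * c\<^sup>2"
      by (simp add: power_mult_distrib mult_left_mono mult.assoc mult.left_commute[of _ "a\<^sup>2"])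
    thus "cosh (a * (d i - d j)) \<le> exp (4 * a\<^sup>2 * c\<^sup>2)"
      using cosh_le_exp_square[of "a * (d i - d j)"] by (meson exp_le_cancel_iff order_trans)
  qed (auto simp: w)
  also have "\<dots> = exp (4 * a\<^sup>2 * c\<^sup>2)"
    using w1 by (simp flip: sum_distrib_left sum_distrib_right)
  finally show ?thesis .
qed

text \<open>The exponential mechanism is concentrated differentially private. With \<open>u\<close> the ratio of the two
weights, the sum is \<open>S \<alpha> = E u powr \<alpha>\<close> under the weights for \<open>q'\<close>, and \<open>exp_moment_ratio_le\<close> gives an
exponent of order \<open>\<alpha>\<^sup>2\<close>. For \<open>\<alpha> \<ge> 2\<close> this is of order \<open>\<alpha> * (\<alpha> - 1)\<close>. For \<open>\<alpha> < 2\<close> it is not, but there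
Jensen's inequality, applied under the weights for \<open>q\<close>, reduces to \<open>\<alpha> = 2\<close>.\<close>
lemma exp_weight_renyi:
  assumes K: "K > 0" and close: "\<And>g. g < K \<Longrightarrow> \<bar>q g - q' g\<bar> \<le> 1" and "0 \<le> \<eta>" and "1 < \<alpha>"
  shows "(\<Sum>g<K. exp_weight K \<eta> q g powr \<alpha> * exp_weight K \<eta> q' g powr (1 - \<alpha>))
      \<le> exp (16 * \<eta>\<^sup>2 * (\<alpha> * (\<alpha> - 1)))"
proof -
  define w where "w = exp_weight K \<eta> q"
  define w' where "w' = exp_weight K \<eta> q'"
  define u where "u = (\<lambda>g. w g / w' g)"
  define S where "S = (\<lambda>b. \<Sum>g<K. w' g * u g powr b)"
  have pos: "0 < w g" "0 < w' g" "0 < u g" for g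
    using exp_weight_pos[OF K] by (auto simp: w_def w'_def u_def)
  have sums: "(\<Sum>g<K. w g) = 1" "(\<Sum>g<K. w' g) = 1"
    by (simp_all add: w_def w'_def sum_exp_weight K)
  (* As w and w' are both exponential weights, u is exp d divided by its own w'-mean Z. *)
  have S_le: "S b \<le> exp (4 * b\<^sup>2 * \<eta>\<^sup>2)" if "0 \<le> b" for b
  proof -
    define d where "d = (\<lambda>g. \<eta> * (q g - q' g))"
    define Z where "Z = (\<Sum>g<K. w' g * exp (d g))"
    have Z: "Z > 0" unfolding Z_def using K pos by (intro sum_pos) auto
    have "Z = (\<Sum>g<K. exp (\<eta> * q g)) / (\<Sum>g<K. exp (\<eta> * q' g))"
      by (simp add: Z_def w'_def exp_weight_def d_def sum_divide_distrib right_diff_distrib exp_diff)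
    hence u: "u g = exp (d g) / Z" for g
      by (simp add: u_def w_def w'_def exp_weight_def d_def right_diff_distrib exp_diff)
    have "S b = (\<Sum>g<K. w' g * exp (b * d g)) * Z powr (- b)"
    proof -
      have "u g powr b = exp (b * d g) * Z powr (- b)" for g
        using Z by (simp add: u powr_def ln_div right_diff_distrib exp_diff exp_minus field_simps)
      thus ?thesis by (simp add: S_def sum_distrib_right mult.assoc)
    qed
    also have "\<dots> \<le> exp (4 * b\<^sup>2 * \<eta>\<^sup>2)"
      unfolding Z_def
    proof (rule exp_moment_ratio_le)
      show "\<bar>d g\<bar> \<le> \<eta>" if "g \<in> {..<K}" for g
        using mult_left_mono[OF close[of g] \<open>0 \<le> \<eta>\<close>] that \<open>0 \<le> \<eta>\<close> by (simp add: d_def abs_mult)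
    qed (use K sums that in \<open>auto intro: less_imp_le[OF pos(2)] simp: lessThan_empty_iff\<close>)
    finally show ?thesis .
  qed
  have "(\<Sum>g<K. w g powr \<alpha> * w' g powr (1 - \<alpha>)) = S \<alpha>"
    unfolding S_def using pos by (intro sum.cong refl) (simp add: u_def powr_divide powr_diff abs_of_pos less_imp_neq[symmetric])
  moreover have "S \<alpha> \<le> exp (16 * \<eta>\<^sup>2 * (\<alpha> * (\<alpha> - 1)))"
  proof (cases "\<alpha> \<ge> 2")
    case True
    have "\<alpha> * 2 \<le> \<alpha> * \<alpha>" using True by (intro mult_left_mono) auto
    hence "\<alpha>\<^sup>2 \<le> 4 * (\<alpha> * (\<alpha> - 1))"
      unfolding power2_eq_square right_diff_distrib using True by linarith
    hence "4 * \<eta>\<^sup>2 * \<alpha>\<^sup>2 \<le> 4 * \<eta>\<^sup>2 * (4 * (\<alpha> * (\<alpha> - 1)))" by (intro mult_left_mono) auto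
    hence "4 * \<alpha>\<^sup>2 * \<eta>\<^sup>2 \<le> 16 * \<eta>\<^sup>2 * (\<alpha> * (\<alpha> - 1))" by (simp add: algebra_simps)
    thus ?thesis using order_trans[OF S_le[of \<alpha>]] True by simp
  next
    case False
    define l where "l = \<alpha> - 1"
    have l: "0 < l" "l < 1" using False \<open>1 < \<alpha>\<close> by (auto simp: l_def)
    have Sl: "S (1 + b) = (\<Sum>g<K. w g * u g powr b)" for b
      unfolding S_def using pos by (intro sum.cong refl) (simp add: powr_add u_def abs_of_pos less_imp_neq[symmetric])
    have "S \<alpha> = (\<Sum>g<K. w g * u g powr l)" using Sl[of l] by (simp add: l_def)
    moreover have "(\<Sum>g<K. w g * u g powr l) powr (1 / l) \<le> (\<Sum>g<K. w g * (u g powr l) powr (1 / l))"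
      using convex_on_sum[OF _ _ powr_convex[of "1 / l"] sums(1), of "\<lambda>g. u g powr l"] K pos[THEN less_imp_le] pos l
      by (simp add: lessThan_empty_iff less_imp_neq[symmetric])
    moreover have "\<dots> = S 2"
      using Sl[of 1] pos l by (simp add: powr_powr less_imp_le)
    ultimately have "S \<alpha> powr (1 / l) \<le> S 2" by simp
    hence "(S \<alpha> powr (1 / l)) powr l \<le> exp (16 * \<eta>\<^sup>2) powr l"
      using S_le[of 2] l by (intro powr_mono2) auto
    moreover have "0 \<le> S \<alpha>" unfolding S_def by (intro sum_nonneg mult_nonneg_nonneg pos[THEN less_imp_le]) auto
    ultimately have "S \<alpha> \<le> exp (16 * \<eta>\<^sup>2 * l)"
      using l by (simp add: powr_powr exp_powr_real)
    also have "\<dots> \<le> exp (16 * \<eta>\<^sup>2 * (\<alpha> * (\<alpha> - 1)))"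
      using \<open>1 < \<alpha>\<close> by (simp add: l_def mult_left_mono)
    finally show ?thesis .
  qed
  ultimately show ?thesis by (simp add: w_def w'_def)
qed

section \<open>Gaussian mixtures with exponential weights\<close>

text \<open>The data-processing inequality for summing out a finite index, as Jensen's inequality for
\<open>t \<mapsto> t powr a\<close> at the points \<open>p i / r i\<close> with weights proportional to \<open>r i\<close>.\<close>
lemma powr_ratio_sum_le:
  fixes p r :: "'i \<Rightarrow> real"
  assumes fin: "finite I" and ne: "I \<noteq> {}" and p: "\<And>i. i \<in> I \<Longrightarrow> 0 < p i" and r: "\<And>i. i \<in> I \<Longrightarrow> 0 < r i"
    and "1 \<le> a"
  shows "(\<Sum>i\<in>I. p i) powr a * (\<Sum>i\<in>I. r i) powr (1 - a) \<le> (\<Sum>i\<in>I. p i powr a * r i powr (1 - a))"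
proof -
  define R where "R = (\<Sum>i\<in>I. r i)"
  have R: "R > 0" unfolding R_def using fin ne r by (intro sum_pos) auto
  have P: "(\<Sum>i\<in>I. p i) > 0" using fin ne p by (intro sum_pos) auto
  have "(\<Sum>i\<in>I. (r i / R) *\<^sub>R (p i / r i)) powr a \<le> (\<Sum>i\<in>I. (r i / R) * (p i / r i) powr a)"
  proof (rule convex_on_sum[OF fin ne powr_convex[OF \<open>1 \<le> a\<close>]])
    show "(\<Sum>i\<in>I. r i / R) = 1"
      using R unfolding sum_divide_distrib[symmetric] R_def[symmetric] by simp
  qed (use p r R in \<open>auto intro: less_imp_le\<close>)
  moreover have "(\<Sum>i\<in>I. (r i / R) *\<^sub>R (p i / r i)) = (\<Sum>i\<in>I. p i) / R"
    unfolding sum_divide_distrib using r by (intro sum.cong refl) (auto simp: less_imp_neq[symmetric])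
  moreover have "R * (\<Sum>i\<in>I. (r i / R) * (p i / r i) powr a) = (\<Sum>i\<in>I. p i powr a * r i powr (1 - a))"
    unfolding sum_distrib_left
  proof (intro sum.cong refl)
    fix i assume "i \<in> I"
    then show "R * (r i / R * (p i / r i) powr a) = p i powr a * r i powr (1 - a)"
      using p[of i] r[of i] R by (simp add: powr_divide powr_diff)
  qed
  ultimately have "R * ((\<Sum>i\<in>I. p i) / R) powr a \<le> (\<Sum>i\<in>I. p i powr a * r i powr (1 - a))"
    using R mult_left_mono[of "((\<Sum>i\<in>I. p i) / R) powr a" "\<Sum>i\<in>I. (r i / R) * (p i / r i) powr a" R] by simp
  moreover have "R * ((\<Sum>i\<in>I. p i) / R) powr a = (\<Sum>i\<in>I. p i) powr a * R powr (1 - a)"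
    using P R by (simp add: powr_divide powr_diff)
  ultimately show ?thesis by (simp add: R_def)
qed

text \<open>Completing the square: the integrand of the Renyi divergence between two Gaussians of equal
variance is a multiple of a third Gaussian density, hence is integrated without computation.\<close>
lemma normal_density_powr_ratio:
  assumes "0 < s"
  shows "normal_density m s y powr \<alpha> * normal_density m' s y powr (1 - \<alpha>)
    = exp (\<alpha> * (\<alpha> - 1) * (m - m')\<^sup>2 / (2 * s\<^sup>2)) * normal_density (\<alpha> * m + (1 - \<alpha>) * m') s y"
proof -
  define c where "c = sqrt (2 * pi * s\<^sup>2)"
  define k where "k = 2 * s\<^sup>2"
  have c: "c > 0" using assms by (simp add: c_def)
  have nd: "normal_density m s y = exp (- (y - m)\<^sup>2 / k - ln c)" for m
    unfolding normal_density_def c_def[symmetric] k_def[symmetric] using c by (simp add: exp_diff)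
  have "\<alpha> * (y - m)\<^sup>2 + (1 - \<alpha>) * (y - m')\<^sup>2 = (y - (\<alpha> * m + (1 - \<alpha>) * m'))\<^sup>2 - \<alpha> * (\<alpha> - 1) * (m - m')\<^sup>2"
    by algebra
  hence "(\<alpha> * (y - m)\<^sup>2 + (1 - \<alpha>) * (y - m')\<^sup>2) / k
      = ((y - (\<alpha> * m + (1 - \<alpha>) * m'))\<^sup>2 - \<alpha> * (\<alpha> - 1) * (m - m')\<^sup>2) / k" by simp
  hence "\<alpha> * (- (y - m)\<^sup>2 / k - ln c) + (1 - \<alpha>) * (- (y - m')\<^sup>2 / k - ln c)
     = \<alpha> * (\<alpha> - 1) * (m - m')\<^sup>2 / k + (- (y - (\<alpha> * m + (1 - \<alpha>) * m'))\<^sup>2 / k - ln c)"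
    unfolding add_divide_distrib diff_divide_distrib right_diff_distrib left_diff_distrib times_divide_eq_right by simp
  thus ?thesis unfolding nd k_def[symmetric] by (simp add: powr_def flip: exp_add)
qed

definition mixture_density :: "nat \<Rightarrow> real \<Rightarrow> real \<Rightarrow> (nat \<Rightarrow> real) \<Rightarrow> (nat \<Rightarrow> real) \<Rightarrow> real \<Rightarrow> real" where
  "mixture_density K \<eta> s q f y = (\<Sum>g<K. exp_weight K \<eta> q g * normal_density (f g) s y)"

text \<open>The law of the output: draw \<open>g\<close> from the exponential weights, then add Gaussian noise to \<open>f g\<close>.
Giving it by an everywhere positive density makes the Renyi divergence an explicit integral.\<close>
definition gaussian_mixture :: "nat \<Rightarrow> real \<Rightarrow> real \<Rightarrow> (nat \<Rightarrow> real) \<Rightarrow> (nat \<Rightarrow> real) \<Rightarrow> real measure" where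
  "gaussian_mixture K \<eta> s q f = density lborel (\<lambda>y. ennreal (mixture_density K \<eta> s q f y))"

lemma measurable_mixture_density [measurable]: "mixture_density K \<eta> s q f \<in> borel_measurable borel"
  unfolding mixture_density_def by measurable

lemma mixture_density_pos: "K > 0 \<Longrightarrow> 0 < s \<Longrightarrow> 0 < mixture_density K \<eta> s q f y"
  unfolding mixture_density_def
  by (intro sum_pos mult_pos_pos exp_weight_pos normal_density_pos) (auto simp: lessThan_empty_iff)

lemma sets_gaussian_mixture [simp]: "sets (gaussian_mixture K \<eta> s q f) = sets borel"
  by (simp add: gaussian_mixture_def)

lemma nn_integral_gaussian_mixture:
  assumes K: "K > 0" and [measurable]: "h \<in> borel_measurable borel"
  shows "(\<integral>\<^sup>+y. h y \<partial>gaussian_mixture K \<eta> s q f)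
    = (\<Sum>g<K. ennreal (exp_weight K \<eta> q g) * (\<integral>\<^sup>+y. ennreal (normal_density (f g) s y) * h y \<partial>lborel))"
proof -
  have p: "0 \<le> exp_weight K \<eta> q g" for g using exp_weight_pos[OF K] less_imp_le by blast
  have "(\<integral>\<^sup>+y. h y \<partial>gaussian_mixture K \<eta> s q f) = (\<integral>\<^sup>+y. ennreal (mixture_density K \<eta> s q f y) * h y \<partial>lborel)"
    unfolding gaussian_mixture_def by (subst nn_integral_density) auto
  also have "\<dots> = (\<integral>\<^sup>+y. (\<Sum>g<K. ennreal (exp_weight K \<eta> q g) * (ennreal (normal_density (f g) s y) * h y)) \<partial>lborel)"
    using p by (intro nn_integral_cong)
      (simp add: mixture_density_def ennreal_mult mult.assoc sum_distrib_right flip: sum_ennreal)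
  also have "\<dots> = (\<Sum>g<K. ennreal (exp_weight K \<eta> q g) * (\<integral>\<^sup>+y. ennreal (normal_density (f g) s y) * h y \<partial>lborel))"
    by (subst nn_integral_sum) (auto intro!: sum.cong nn_integral_cmult)
  finally show ?thesis .
qed

lemma nn_integral_normal_density: "0 < s \<Longrightarrow> (\<integral>\<^sup>+y. ennreal (normal_density m s y) \<partial>lborel) = 1"
  by (subst nn_integral_eq_integral) auto

lemma prob_space_gaussian_mixture:
  assumes K: "K > 0" and s: "0 < s"
  shows "prob_space (gaussian_mixture K \<eta> s q f)"
proof
  have "emeasure (gaussian_mixture K \<eta> s q f) (space (gaussian_mixture K \<eta> s q f))
      = (\<integral>\<^sup>+y. 1 \<partial>gaussian_mixture K \<eta> s q f)" by simp
  also have "\<dots> = (\<Sum>g<K. ennreal (exp_weight K \<eta> q g))"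
    using nn_integral_gaussian_mixture[OF K, of "\<lambda>_. 1"] s by (simp add: nn_integral_normal_density)
  also have "\<dots> = 1"
    using exp_weight_pos[OF K] sum_exp_weight[OF K] by (subst sum_ennreal) (auto intro: less_imp_le)
  finally show "emeasure (gaussian_mixture K \<eta> s q f) (space (gaussian_mixture K \<eta> s q f)) = 1" .
qed

lemma normal_density_mean_square_error:
  assumes s: "0 < s"
  shows "(\<integral>\<^sup>+y. ennreal (normal_density m s y) * ennreal ((y - \<mu>)\<^sup>2) \<partial>lborel) = ennreal ((m - \<mu>)\<^sup>2 + s\<^sup>2)"
proof -
  have 1: "has_bochner_integral lborel (\<lambda>y. normal_density m s y * (y - m)\<^sup>2) (s\<^sup>2)"
    using normal_moment_even[OF s, of m 1] by (simp add: fact_numeral)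
  have 2: "has_bochner_integral lborel (\<lambda>y. normal_density m s y * (y - m)) 0"
    using normal_moment_odd[OF s, of m 0] by simp
  have 3: "has_bochner_integral lborel (normal_density m s) 1"
    using normal_moment_even[OF s, of m 0] by simp
  have "has_bochner_integral lborel (\<lambda>y. normal_density m s y * (y - m)\<^sup>2
      + 2 * (m - \<mu>) * (normal_density m s y * (y - m)) + (m - \<mu>)\<^sup>2 * normal_density m s y)
      (s\<^sup>2 + 2 * (m - \<mu>) * 0 + (m - \<mu>)\<^sup>2 * 1)"
    by (intro has_bochner_integral_add has_bochner_integral_mult_right 1 2 3)
  also have "(\<lambda>y. normal_density m s y * (y - m)\<^sup>2
      + 2 * (m - \<mu>) * (normal_density m s y * (y - m)) + (m - \<mu>)\<^sup>2 * normal_density m s y)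
      = (\<lambda>y. normal_density m s y * (y - \<mu>)\<^sup>2)"
    by (auto simp: algebra_simps power2_eq_square)
  finally have "(\<integral>\<^sup>+y. ennreal (normal_density m s y * (y - \<mu>)\<^sup>2) \<partial>lborel) = ennreal ((m - \<mu>)\<^sup>2 + s\<^sup>2)"
    by (subst nn_integral_eq_integral) (auto simp: has_bochner_integral_iff)
  thus ?thesis by (simp add: ennreal_mult)
qed

text \<open>The noise contributes exactly \<open>s\<^sup>2\<close>, since it is centred and independent of the selection.\<close>
lemma gaussian_mixture_mean_square_error:
  assumes K: "K > 0" and s: "0 < s"
  shows "(\<integral>\<^sup>+y. ennreal ((y - \<mu>)\<^sup>2) \<partial>gaussian_mixture K \<eta> s q f)
    = ennreal ((\<Sum>g<K. exp_weight K \<eta> q g * (f g - \<mu>)\<^sup>2) + s\<^sup>2)"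
proof -
  have p: "0 \<le> exp_weight K \<eta> q g" for g using exp_weight_pos[OF K] less_imp_le by blast
  have "(\<integral>\<^sup>+y. ennreal ((y - \<mu>)\<^sup>2) \<partial>gaussian_mixture K \<eta> s q f)
    = (\<Sum>g<K. ennreal (exp_weight K \<eta> q g * ((f g - \<mu>)\<^sup>2 + s\<^sup>2)))"
    using p s by (simp add: nn_integral_gaussian_mixture[OF K] normal_density_mean_square_error ennreal_mult)
  also have "\<dots> = ennreal (\<Sum>g<K. exp_weight K \<eta> q g * ((f g - \<mu>)\<^sup>2 + s\<^sup>2))"
    using p by (intro sum_ennreal) auto
  also have "(\<Sum>g<K. exp_weight K \<eta> q g * ((f g - \<mu>)\<^sup>2 + s\<^sup>2))
      = (\<Sum>g<K. exp_weight K \<eta> q g * (f g - \<mu>)\<^sup>2) + s\<^sup>2"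
    using sum_exp_weight[OF K, of \<eta> q] by (simp add: distrib_left sum.distrib flip: sum_distrib_right)
  finally show ?thesis .
qed

text \<open>Access to the definition of \<open>renyi_divergence\<close>: for positive densities the Radon-Nikodym derivative
is the quotient \<open>h / h'\<close>, up to a null set.\<close>
lemma renyi_divergence_density_le:
  fixes h h' :: "real \<Rightarrow> real"
  assumes [measurable]: "h \<in> borel_measurable borel" "h' \<in> borel_measurable borel"
    and pos: "\<And>y. 0 < h y" "\<And>y. 0 < h' y"
    and prob: "prob_space (density lborel h')" and \<alpha>: "1 < \<alpha>" and "0 \<le> c"
    and le: "(\<integral>\<^sup>+y. ennreal (h y powr \<alpha> * h' y powr (1 - \<alpha>)) \<partial>lborel) \<le> ennreal (exp ((\<alpha> - 1) * c))"
  shows "renyi_divergence \<alpha> (density lborel h) (density lborel h') \<le> ereal c"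
proof -
  let ?P = "density lborel (\<lambda>y. ennreal (h y))" and ?Q = "density lborel (\<lambda>y. ennreal (h' y))"
  define r where "r = (\<lambda>y. h y / h' y)"
  have [measurable]: "r \<in> borel_measurable borel" unfolding r_def by measurable
  interpret Q: prob_space ?Q by fact
  have dens: "density ?Q (\<lambda>y. ennreal (r y)) = ?P"
    using pos by (subst density_density_eq) (auto simp: r_def less_imp_le less_imp_neq[symmetric] simp flip: ennreal_mult)
  have abs: "absolutely_continuous ?Q ?P"
  proof -
    have "ennreal (h y) \<noteq> 0" "ennreal (h' y) \<noteq> 0" for y
      using pos by (simp_all add: ennreal_eq_0_iff not_le)
    thus ?thesis by (auto simp: absolutely_continuous_def null_sets_density_iff)
  qed
  have rn: "AE y in ?Q. ennreal (r y) = RN_deriv ?Q ?P y"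
    using dens by (intro Q.RN_deriv_unique) auto
  hence rn': "AE y in ?P. ennreal (r y) = RN_deriv ?Q ?P y"
    using pos by (simp add: AE_density)
  define J where "J = (\<integral>\<^sup>+y. ennreal (enn2real (RN_deriv ?Q ?P y) powr (\<alpha> - 1)) \<partial>?P)"
  have "J = (\<integral>\<^sup>+y. ennreal (r y powr (\<alpha> - 1)) \<partial>?P)"
    unfolding J_def
  proof (intro nn_integral_cong_AE, use rn' in eventually_elim)
    case (elim y)
    have "0 \<le> r y" using pos by (simp add: r_def less_imp_le)
    hence "enn2real (RN_deriv ?Q ?P y) = r y" using elim by (metis enn2real_ennreal)
    thus ?case by simp
  qed
  also have "\<dots> = (\<integral>\<^sup>+y. ennreal (h y) * ennreal (r y powr (\<alpha> - 1)) \<partial>lborel)"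
    by (subst nn_integral_density) auto
  also have "\<dots> = (\<integral>\<^sup>+y. ennreal (h y powr \<alpha> * h' y powr (1 - \<alpha>)) \<partial>lborel)"
  proof (intro nn_integral_cong)
    fix y
    have "h y * (h y / h' y) powr (\<alpha> - 1) = h y powr \<alpha> * h' y powr (1 - \<alpha>)"
      using pos[of y] by (simp add: powr_divide powr_diff less_imp_neq[symmetric] field_simps)
    thus "ennreal (h y) * ennreal (r y powr (\<alpha> - 1)) = ennreal (h y powr \<alpha> * h' y powr (1 - \<alpha>))"
      using pos[of y] by (simp add: r_def less_imp_le flip: ennreal_mult)
  qed
  finally have J: "J \<le> ennreal (exp ((\<alpha> - 1) * c))" using le by simp
  have fin: "J < \<infinity>" using J by (simp add: le_less_trans)
  have "1 / (\<alpha> - 1) * ln (enn2real J) \<le> c"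
  proof (cases "enn2real J = 0")
    case False
    have "enn2real J \<le> exp ((\<alpha> - 1) * c)" using J by (intro enn2real_leI) auto
    moreover have "0 < enn2real J" using False by (simp add: order_less_le)
    ultimately have "ln (enn2real J) \<le> (\<alpha> - 1) * c" by (metis ln_exp ln_mono)
    thus ?thesis using \<alpha> by (simp add: field_simps)
  qed (use \<open>0 \<le> c\<close> in simp)
  thus ?thesis
    using abs fin unfolding renyi_divergence_def Let_def J_def[symmetric] by simp
qed

text \<open>Adaptive composition of the selection and the noise. The pair of both outcomes has densities that
are products, so the two contributions to the exponent add; passing to the second outcome alone
is \<open>powr_ratio_sum_le\<close>.\<close>
lemma renyi_divergence_gaussian_mixture:
  assumes K: "K > 0" and s: "0 < s" and \<alpha>: "1 < \<alpha>" and "0 \<le> \<eta>"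
    and q: "\<And>g. g < K \<Longrightarrow> \<bar>q g - q' g\<bar> \<le> 1" and f: "\<And>g. g < K \<Longrightarrow> \<bar>f g - f' g\<bar> \<le> \<Delta>"
  shows "renyi_divergence \<alpha> (gaussian_mixture K \<eta> s q f) (gaussian_mixture K \<eta> s q' f')
    \<le> ereal ((16 * \<eta>\<^sup>2 + \<Delta>\<^sup>2 / (2 * s\<^sup>2)) * \<alpha>)"
  unfolding gaussian_mixture_def
proof (rule renyi_divergence_density_le)
  let ?w = "exp_weight K \<eta> q" and ?w' = "exp_weight K \<eta> q'"
  have w: "0 < ?w g" "0 < ?w' g" for g by (simp_all add: exp_weight_pos[OF K])
  define E where "E = exp (\<alpha> * (\<alpha> - 1) * \<Delta>\<^sup>2 / (2 * s\<^sup>2))"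
  have "(\<integral>\<^sup>+y. ennreal (mixture_density K \<eta> s q f y powr \<alpha> * mixture_density K \<eta> s q' f' y powr (1 - \<alpha>)) \<partial>lborel)
    \<le> (\<integral>\<^sup>+y. (\<Sum>g<K. ennreal (?w g powr \<alpha> * ?w' g powr (1 - \<alpha>) * E)
          * ennreal (normal_density (\<alpha> * f g + (1 - \<alpha>) * f' g) s y)) \<partial>lborel)"
  proof (intro nn_integral_mono)
    fix y
    let ?n = "\<lambda>g. normal_density (f g) s y" and ?n' = "\<lambda>g. normal_density (f' g) s y"
    have n: "0 < ?n g" "0 < ?n' g" for g using s by (simp_all add: normal_density_pos)
    have "mixture_density K \<eta> s q f y powr \<alpha> * mixture_density K \<eta> s q' f' y powr (1 - \<alpha>)
        \<le> (\<Sum>g<K. (?w g * ?n g) powr \<alpha> * (?w' g * ?n' g) powr (1 - \<alpha>))"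
      unfolding mixture_density_def using K w n \<alpha>
      by (intro powr_ratio_sum_le) (auto simp: lessThan_empty_iff)
    also have "\<dots> \<le> (\<Sum>g<K. (?w g powr \<alpha> * ?w' g powr (1 - \<alpha>) * E) * normal_density (\<alpha> * f g + (1 - \<alpha>) * f' g) s y)"
    proof (intro sum_mono)
      fix g assume "g \<in> {..<K}"
      hence "(f g - f' g)\<^sup>2 \<le> \<Delta>\<^sup>2" using f[of g]
        by (metis abs_le_square_iff abs_of_nonneg abs_ge_zero order_trans lessThan_iff)
      hence "exp (\<alpha> * (\<alpha> - 1) * (f g - f' g)\<^sup>2 / (2 * s\<^sup>2)) \<le> E"
        unfolding E_def using \<alpha> by (simp add: divide_right_mono mult_left_mono)
      hence "?n g powr \<alpha> * ?n' g powr (1 - \<alpha>) \<le> E * normal_density (\<alpha> * f g + (1 - \<alpha>) * f' g) s y"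
        unfolding normal_density_powr_ratio[OF s] by (intro mult_right_mono) auto
      hence "(?w g powr \<alpha> * ?w' g powr (1 - \<alpha>)) * (?n g powr \<alpha> * ?n' g powr (1 - \<alpha>))
          \<le> (?w g powr \<alpha> * ?w' g powr (1 - \<alpha>)) * (E * normal_density (\<alpha> * f g + (1 - \<alpha>) * f' g) s y)"
        by (intro mult_left_mono) auto
      thus "(?w g * ?n g) powr \<alpha> * (?w' g * ?n' g) powr (1 - \<alpha>)
          \<le> (?w g powr \<alpha> * ?w' g powr (1 - \<alpha>) * E) * normal_density (\<alpha> * f g + (1 - \<alpha>) * f' g) s y"
        using w n by (simp add: powr_mult less_imp_le mult_ac)
    qed
    finally have le: "mixture_density K \<eta> s q f y powr \<alpha> * mixture_density K \<eta> s q' f' y powr (1 - \<alpha>)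
        \<le> (\<Sum>g<K. (?w g powr \<alpha> * ?w' g powr (1 - \<alpha>) * E) * normal_density (\<alpha> * f g + (1 - \<alpha>) * f' g) s y)" .
    show "ennreal (mixture_density K \<eta> s q f y powr \<alpha> * mixture_density K \<eta> s q' f' y powr (1 - \<alpha>))
      \<le> (\<Sum>g<K. ennreal (?w g powr \<alpha> * ?w' g powr (1 - \<alpha>) * E) * ennreal (normal_density (\<alpha> * f g + (1 - \<alpha>) * f' g) s y))"
    proof -
      have "0 \<le> ?w g powr \<alpha> * ?w' g powr (1 - \<alpha>) * E" for g by (simp add: E_def)
      hence "(\<Sum>g<K. ennreal (?w g powr \<alpha> * ?w' g powr (1 - \<alpha>) * E) * ennreal (normal_density (\<alpha> * f g + (1 - \<alpha>) * f' g) s y))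
        = (\<Sum>g<K. ennreal (?w g powr \<alpha> * ?w' g powr (1 - \<alpha>) * E * normal_density (\<alpha> * f g + (1 - \<alpha>) * f' g) s y))"
        by (intro sum.cong refl) (rule ennreal_mult[symmetric], auto)
      also have "\<dots> = ennreal (\<Sum>g<K. ?w g powr \<alpha> * ?w' g powr (1 - \<alpha>) * E * normal_density (\<alpha> * f g + (1 - \<alpha>) * f' g) s y)"
        by (rule sum_ennreal) (simp add: E_def)
      finally show ?thesis using le by (simp add: ennreal_leI)
    qed
  qed
  also have "\<dots> = (\<Sum>g<K. ennreal (?w g powr \<alpha> * ?w' g powr (1 - \<alpha>) * E))"
    using s by (subst nn_integral_sum) (auto simp: nn_integral_cmult nn_integral_normal_density)
  also have "\<dots> = ennreal ((\<Sum>g<K. ?w g powr \<alpha> * ?w' g powr (1 - \<alpha>)) * E)"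
    by (simp add: E_def sum_distrib_right)
  also have "\<dots> \<le> ennreal (exp (16 * \<eta>\<^sup>2 * (\<alpha> * (\<alpha> - 1))) * E)"
    using exp_weight_renyi[OF K q \<open>0 \<le> \<eta>\<close> \<alpha>] by (intro ennreal_leI mult_right_mono) (auto simp: E_def)
  also have "exp (16 * \<eta>\<^sup>2 * (\<alpha> * (\<alpha> - 1))) * E = exp ((\<alpha> - 1) * ((16 * \<eta>\<^sup>2 + \<Delta>\<^sup>2 / (2 * s\<^sup>2)) * \<alpha>))"
    unfolding E_def by (simp add: algebra_simps add_divide_distrib diff_divide_distrib flip: exp_add)
  finally show "(\<integral>\<^sup>+y. ennreal (mixture_density K \<eta> s q f y powr \<alpha> * mixture_density K \<eta> s q' f' y powr (1 - \<alpha>)) \<partial>lborel)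
     \<le> ennreal (exp ((\<alpha> - 1) * ((16 * \<eta>\<^sup>2 + \<Delta>\<^sup>2 / (2 * s\<^sup>2)) * \<alpha>)))" .
  show "prob_space (density lborel (\<lambda>y. ennreal (mixture_density K \<eta> s q' f' y)))"
    using prob_space_gaussian_mixture[OF K s, of \<eta> q' f'] by (simp add: gaussian_mixture_def)
qed (use K s \<alpha> in \<open>auto intro!: mixture_density_pos\<close>)

section \<open>Measurability and privacy of the mechanism\<close>

lemma randomized_algorithm_gaussian_mixture:
  assumes K: "K > 0" and s: "0 < s"
    and q: "\<And>g. g < K \<Longrightarrow> (\<lambda>x. q x g) \<in> borel_measurable (real_vec n)"
    and f: "\<And>g. g < K \<Longrightarrow> (\<lambda>x. f x g) \<in> borel_measurable (real_vec n)"
  shows "randomized_algorithm n (\<lambda>x. gaussian_mixture K \<eta> s (q x) (f x))"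
  unfolding randomized_algorithm_def
proof (rule measurable_prob_algebraI)
  show "prob_space (gaussian_mixture K \<eta> s (q x) (f x))" for x
    by (rule prob_space_gaussian_mixture[OF K s])
  show "(\<lambda>x. gaussian_mixture K \<eta> s (q x) (f x)) \<in> real_vec n \<rightarrow>\<^sub>M subprob_algebra borel"
  proof (rule measurable_subprob_algebra)
    show "subprob_space (gaussian_mixture K \<eta> s (q x) (f x))" for x
      by (rule prob_space_imp_subprob_space[OF prob_space_gaussian_mixture[OF K s]])
    fix A :: "real set" assume [measurable]: "A \<in> sets borel"
    have [measurable]: "(\<lambda>z. mixture_density K \<eta> s (q (fst z)) (f (fst z)) (snd z)) \<in> borel_measurable (real_vec n \<Otimes>\<^sub>M lborel)"
      unfolding mixture_density_def
    proof (intro borel_measurable_sum)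
      have Q: "(\<lambda>z. q (fst z) g) \<in> borel_measurable (real_vec n \<Otimes>\<^sub>M lborel)" if "g < K" for g
        using q[OF that] by (rule measurable_compose[OF measurable_fst])
      have "(\<lambda>z. \<Sum>j<K. exp (\<eta> * q (fst z) j)) \<in> borel_measurable (real_vec n \<Otimes>\<^sub>M lborel)"
      proof (intro borel_measurable_sum)
        fix j assume "j \<in> {..<K}"
        hence "j < K" by simp
        note [measurable] = Q[OF this]
        show "(\<lambda>z. exp (\<eta> * q (fst z) j)) \<in> borel_measurable (real_vec n \<Otimes>\<^sub>M lborel)" by measurable
      qed
      note [measurable] = this
      fix g assume "g \<in> {..<K}"
      hence g: "g < K" by simp
      have F: "(\<lambda>z. f (fst z) g) \<in> borel_measurable (real_vec n \<Otimes>\<^sub>M lborel)"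
        using f[OF g] by (rule measurable_compose[OF measurable_fst])
      note [measurable] = Q[OF g] F
      show "(\<lambda>z. exp_weight K \<eta> (q (fst z)) g * normal_density (f (fst z) g) s (snd z)) \<in> borel_measurable (real_vec n \<Otimes>\<^sub>M lborel)"
        unfolding exp_weight_def normal_density_def by measurable
    qed
    have "(\<lambda>x. emeasure (gaussian_mixture K \<eta> s (q x) (f x)) A)
       = (\<lambda>x. \<integral>\<^sup>+y. ennreal (mixture_density K \<eta> s (q x) (f x) y) * indicator A y \<partial>lborel)"
      unfolding gaussian_mixture_def by (subst emeasure_density) auto
    also have "\<dots> \<in> borel_measurable (real_vec n)"
      by (rule sigma_finite_measure.borel_measurable_nn_integral[OF sigma_finite_lborel])
         (simp add: split_beta')
    finally show "(\<lambda>x. emeasure (gaussian_mixture K \<eta> s (q x) (f x)) A) \<in> borel_measurable (real_vec n)" .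
  qed simp
qed

text \<open>The budget: the selection with parameter \<open>\<epsilon> / 8\<close> costs \<open>16 * (\<epsilon> / 8)\<^sup>2 = \<epsilon>\<^sup>2 / 4\<close>, and noise of standard
deviation at least \<open>2 * \<Delta> / \<epsilon>\<close> costs at most \<open>\<epsilon>\<^sup>2 / 8\<close>.\<close>
lemma concentrated_DP_gaussian_mixture:
  assumes K: "K > 0" and "0 < \<epsilon>" "0 < s" and s: "2 * \<Delta> \<le> s * \<epsilon>" "0 \<le> \<Delta>"
    and q: "\<And>x y g. card {i \<in> {..<n}. x i \<noteq> y i} \<le> 1 \<Longrightarrow> g < K \<Longrightarrow> \<bar>q x g - q y g\<bar> \<le> 1"
    and f: "\<And>x y g. card {i \<in> {..<n}. x i \<noteq> y i} \<le> 1 \<Longrightarrow> g < K \<Longrightarrow> \<bar>f x g - f y g\<bar> \<le> \<Delta>"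
  shows "concentrated_DP n (1 / 2 * \<epsilon>\<^sup>2) (\<lambda>x. gaussian_mixture K (\<epsilon> / 8) s (q x) (f x))"
  unfolding concentrated_DP_def
proof (intro ballI impI allI)
  fix x y :: "nat \<Rightarrow> real" and \<alpha> :: real
  assume nb: "card {i \<in> {..<n}. x i \<noteq> y i} \<le> 1" and \<alpha>: "1 < \<alpha>"
  have "renyi_divergence \<alpha> (gaussian_mixture K (\<epsilon> / 8) s (q x) (f x)) (gaussian_mixture K (\<epsilon> / 8) s (q y) (f y))
     \<le> ereal ((16 * (\<epsilon> / 8)\<^sup>2 + \<Delta>\<^sup>2 / (2 * s\<^sup>2)) * \<alpha>)"
    using assms \<alpha> nb by (intro renyi_divergence_gaussian_mixture) auto
  also have "\<dots> \<le> ereal (1 / 2 * \<epsilon>\<^sup>2 * \<alpha>)"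
  proof -
    have "(2 * \<Delta>)\<^sup>2 \<le> (s * \<epsilon>)\<^sup>2" using s by (intro power_mono) auto
    hence "\<Delta>\<^sup>2 / (2 * s\<^sup>2) \<le> \<epsilon>\<^sup>2 / 8" using \<open>0 < s\<close> by (simp add: field_simps power_mult_distrib)
    moreover have "16 * (\<epsilon> / 8)\<^sup>2 = \<epsilon>\<^sup>2 / 4" by (simp add: power_divide)
    moreover have "0 \<le> \<epsilon>\<^sup>2" by simp
    ultimately have "16 * (\<epsilon> / 8)\<^sup>2 + \<Delta>\<^sup>2 / (2 * s\<^sup>2) \<le> 1 / 2 * \<epsilon>\<^sup>2" by linarith
    thus ?thesis using \<alpha> by (simp add: mult_right_mono)
  qed
  finally show "renyi_divergence \<alpha> (gaussian_mixture K (\<epsilon> / 8) s (q x) (f x)) (gaussian_mixture K (\<epsilon> / 8) s (q y) (f y))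
     \<le> ereal (1 / 2 * \<epsilon>\<^sup>2 * \<alpha>)" .
qed

text \<open>Sensitivity of a sum over the samples: neighbouring inputs differ in at most one summand.\<close>
lemma abs_sum_diff_le_range:
  fixes x y :: "nat \<Rightarrow> real" and \<phi> :: "real \<Rightarrow> real"
  assumes nb: "card {i \<in> {..<n}. x i \<noteq> y i} \<le> 1" and range: "\<And>u v. \<bar>\<phi> u - \<phi> v\<bar> \<le> c"
  shows "\<bar>(\<Sum>i<n. \<phi> (x i)) - (\<Sum>i<n. \<phi> (y i))\<bar> \<le> c"
proof -
  let ?S = "{i \<in> {..<n}. x i \<noteq> y i}"
  have c: "0 \<le> c" using range[of 0 0] by simp
  have "\<bar>(\<Sum>i<n. \<phi> (x i)) - (\<Sum>i<n. \<phi> (y i))\<bar> \<le> (\<Sum>i<n. \<bar>\<phi> (x i) - \<phi> (y i)\<bar>)"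
    by (simp flip: sum_subtractf)
  also have "\<dots> = (\<Sum>i\<in>?S. \<bar>\<phi> (x i) - \<phi> (y i)\<bar>)"
    by (rule sum.mono_neutral_right) auto
  also have "\<dots> \<le> (\<Sum>i\<in>?S. c)" by (intro sum_mono range)
  also have "\<dots> \<le> 1 * c" using nb mult_right_mono[of "real (card ?S)" 1 c] c by simp
  finally show ?thesis by simp
qed

section \<open>Moments of subgaussian samples\<close>

lemma cosh_ge_quadratic: "1 + z\<^sup>2 / 2 \<le> cosh (z::real)"
proof -
  have "1 + y\<^sup>2 / 2 \<le> cosh y" if y: "0 \<le> y" for y :: real
  proof -
    define a where "a = y / 2"
    have a: "0 \<le> a" using y by (simp add: a_def)
    have e: "1 + a + a\<^sup>2 / 2 \<le> exp a" using exp_lower_Taylor_quadratic[OF a] by simp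
    have "exp (- a) * (1 + a + a\<^sup>2 / 2) \<le> exp (- a) * exp a" using e by (intro mult_left_mono) auto
    hence "exp (- a) * (1 + a + a\<^sup>2 / 2) \<le> 1" by (simp flip: exp_add)
    also have "1 \<le> (1 - a + a\<^sup>2 / 2) * (1 + a + a\<^sup>2 / 2)"
    proof -
      have "(1 - a + a\<^sup>2 / 2) * (1 + a + a\<^sup>2 / 2) = 1 + (a\<^sup>2)\<^sup>2 / 4"
        by (simp add: algebra_simps power2_eq_square)
      thus ?thesis by simp
    qed
    finally have "exp (- a) \<le> 1 - a + a\<^sup>2 / 2"
      using a by (simp add: mult_le_cancel_right add_pos_nonneg)
    hence "2 * a \<le> exp a - exp (- a)" using e by simp
    hence "(2 * a)\<^sup>2 \<le> (exp a - exp (- a))\<^sup>2" using a by (intro power_mono) auto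
    also have "\<dots> = exp y + exp (- y) - 2"
      by (simp add: power2_eq_square algebra_simps a_def flip: exp_add)
    finally show ?thesis by (simp add: a_def cosh_def)
  qed
  from this[of "\<bar>z\<bar>"] show ?thesis by (cases "z \<ge> 0") auto
qed

text \<open>At \<open>u = 0\<close> both sides agree, so that their difference has a minimum there and its derivative
\<open>- c\<close> vanishes.\<close>
lemma linear_le_exp_square_imp_zero:
  assumes "\<And>u::real. 1 + u * c \<le> exp (u\<^sup>2 * v / 2)"
  shows "c = 0"
proof -
  have "((\<lambda>u. exp (u\<^sup>2 * v / 2) - (1 + u * c)) has_real_derivative - c) (at 0)"
    by (auto intro!: derivative_eq_intros)
  hence "- c = 0"
    by (rule DERIV_local_min[of _ _ _ 1]) (use assms in auto)
  thus ?thesis by simp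
qed

lemma linear_le_exp_imp_le:
  assumes le: "\<And>w::real. 0 \<le> w \<Longrightarrow> 1 + w * m \<le> exp (w * v)" and v: "0 < v"
  shows "m \<le> v"
proof (rule field_le_epsilon)
  fix e :: real assume e: "0 < e"
  (* Small enough for exp x \<le> 1 + x + x\<^sup>2 at x = w * v, and for the quadratic term to stay below e. *)
  define w where "w = min (1 / v) (e / v\<^sup>2)"
  have w: "0 < w" "w * v \<le> 1" "w * v\<^sup>2 \<le> e"
    using v e by (auto simp: w_def field_simps min_def)
  have "1 + w * m \<le> 1 + w * v + (w * v)\<^sup>2"
    using le[of w] exp_bound[of "w * v"] w v by fastforce
  hence "w * m \<le> w * (v + w * v\<^sup>2)" by (simp add: algebra_simps power2_eq_square)
  hence "m \<le> v + w * v\<^sup>2" using w by simp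
  thus "m \<le> v + e" using w by linarith
qed

text \<open>The mean and the variance are read off from the behaviour of the moment generating function at 0:
\<open>1 + u * Z \<le> exp (u * Z)\<close> for the mean, \<open>1 + (u * Z)\<^sup>2 / 2 \<le> cosh (u * Z)\<close> for the second moment. Applied
to the sum of a sample, the last part gives the variance of the sample mean without a discussion
of covariances.\<close>
lemma (in prob_space) subgaussian_mgf_moments:
  fixes Z :: "'a \<Rightarrow> real"
  assumes Z [measurable]: "Z \<in> borel_measurable M" and v: "0 < v"
    and mgf: "\<And>u. (\<integral>\<^sup>+\<omega>. ennreal (exp (u * Z \<omega>)) \<partial>M) \<le> ennreal (exp (u\<^sup>2 * v / 2))"
  shows "integrable M Z" "expectation Z = 0" "(\<integral>\<^sup>+\<omega>. ennreal ((Z \<omega>)\<^sup>2) \<partial>M) \<le> ennreal v"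
proof -
  have int: "integrable M (\<lambda>\<omega>. exp (u * Z \<omega>))" for u
    using mgf[of u] by (intro integrableI_nonneg) (auto intro: le_less_trans)
  have le: "expectation (\<lambda>\<omega>. exp (u * Z \<omega>)) \<le> exp (u\<^sup>2 * v / 2)" for u
    using mgf[of u] int[of u] by (simp add: nn_integral_eq_integral)
  have cosh_int: "integrable M (\<lambda>\<omega>. cosh (u * Z \<omega>))" for u
    using int[of u] int[of "- u"] by (simp add: cosh_def)
  show intZ: "integrable M Z"
  proof (rule Bochner_Integration.integrable_bound[OF cosh_int[of 1]])
    show "AE \<omega> in M. norm (Z \<omega>) \<le> norm (cosh (1 * Z \<omega>))"
    proof (intro always_eventually allI)
      fix \<omega>
      have "0 \<le> (\<bar>Z \<omega>\<bar> - 1)\<^sup>2" by simp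
      hence "\<bar>Z \<omega>\<bar> \<le> 1 + (Z \<omega>)\<^sup>2 / 2" by (simp add: power2_diff)
      thus "norm (Z \<omega>) \<le> norm (cosh (1 * Z \<omega>))" using cosh_ge_quadratic[of "Z \<omega>"] by simp
    qed
  qed auto
  show "expectation Z = 0"
  proof (rule linear_le_exp_square_imp_zero)
    fix u :: real
    have "1 + u * expectation Z = expectation (\<lambda>\<omega>. 1 + u * Z \<omega>)" using intZ by (simp add: prob_space)
    also have "\<dots> \<le> expectation (\<lambda>\<omega>. exp (u * Z \<omega>))"
      using intZ int by (intro integral_mono) auto
    finally show "1 + u * expectation Z \<le> exp (u\<^sup>2 * v / 2)" using le[of u] by linarith
  qed
  have intZ2: "integrable M (\<lambda>\<omega>. (Z \<omega>)\<^sup>2)"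
  proof (rule Bochner_Integration.integrable_bound[of _ "\<lambda>\<omega>. 2 * cosh (1 * Z \<omega>)"])
    show "AE \<omega> in M. norm ((Z \<omega>)\<^sup>2) \<le> norm (2 * cosh (1 * Z \<omega>))"
    proof (intro always_eventually allI)
      fix \<omega> show "norm ((Z \<omega>)\<^sup>2) \<le> norm (2 * cosh (1 * Z \<omega>))"
        using cosh_ge_quadratic[of "Z \<omega>"] by simp
    qed
  qed (use cosh_int[of 1] in auto)
  have "expectation (\<lambda>\<omega>. (Z \<omega>)\<^sup>2) \<le> v"
  proof (rule linear_le_exp_imp_le[OF _ v])
    fix w :: real assume w: "0 \<le> w"
    define u where "u = sqrt (2 * w)"
    have u: "u\<^sup>2 = 2 * w" using w by (simp add: u_def)
    have "1 + w * expectation (\<lambda>\<omega>. (Z \<omega>)\<^sup>2) = expectation (\<lambda>\<omega>. 1 + w * (Z \<omega>)\<^sup>2)"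
      using intZ2 by (simp add: prob_space)
    also have "\<dots> \<le> expectation (\<lambda>\<omega>. cosh (u * Z \<omega>))"
    proof (intro integral_mono)
      fix \<omega> show "1 + w * (Z \<omega>)\<^sup>2 \<le> cosh (u * Z \<omega>)"
        using cosh_ge_quadratic[of "u * Z \<omega>"] u by (simp add: power_mult_distrib)
    qed (use cosh_int intZ2 in auto)
    also have "\<dots> \<le> exp (u\<^sup>2 * v / 2)"
      using int[of u] int[of "- u"] le[of u] le[of "- u"] by (simp add: cosh_def)
    finally show "1 + w * expectation (\<lambda>\<omega>. (Z \<omega>)\<^sup>2) \<le> exp (w * v)" using u by simp
  qed
  thus "(\<integral>\<^sup>+\<omega>. ennreal ((Z \<omega>)\<^sup>2) \<partial>M) \<le> ennreal v"
    using intZ2 by (simp add: nn_integral_eq_integral ennreal_leI)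
qed

text \<open>The centre in the definition of \<open>subgaussian\<close> is an arbitrary real; it has to be the mean.\<close>
lemma subgaussian_about_mean:
  assumes "prob_space D" and sets: "sets D = sets borel" and sg: "subgaussian \<sigma> D" and "0 < \<sigma>"
  shows "(\<integral>\<^sup>+x. ennreal (exp (u * (x - (\<integral>x. x \<partial>D)))) \<partial>D) \<le> ennreal (exp (u\<^sup>2 * \<sigma>\<^sup>2 / 2))"
proof -
  interpret prob_space D by fact
  obtain m where m: "\<And>u. (\<integral>\<^sup>+x. ennreal (exp (u * (x - m))) \<partial>D) \<le> ennreal (exp (u\<^sup>2 * \<sigma>\<^sup>2 / 2))"
    using sg by (auto simp: subgaussian_def)
  have [measurable]: "(\<lambda>x. x - m) \<in> borel_measurable D"
    by (subst measurable_cong_sets[OF sets refl]) auto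
  have "integrable D (\<lambda>x. x - m)" and 0: "expectation (\<lambda>x. x - m) = 0"
    using subgaussian_mgf_moments(1,2)[of "\<lambda>x. x - m" "\<sigma>\<^sup>2"] m \<open>0 < \<sigma>\<close> by auto
  hence "integrable D (\<lambda>x. (x - m) + m)" by (intro Bochner_Integration.integrable_add) auto
  hence "integrable D (\<lambda>x. x)" by simp
  hence "(\<integral>x. x \<partial>D) = m" using 0 by (simp add: prob_space)
  thus ?thesis using m by simp
qed

lemma nn_integral_PiM_prod:
  fixes h :: "'a \<Rightarrow> ennreal"
  assumes "prob_space D" and [measurable]: "h \<in> borel_measurable D"
  shows "(\<integral>\<^sup>+x. (\<Prod>i<n. h (x i)) \<partial>Pi\<^sub>M {..<n} (\<lambda>_. D)) = (\<integral>\<^sup>+z. h z \<partial>D) ^ n"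
proof -
  interpret D: prob_space D by fact
  interpret product_sigma_finite "\<lambda>_::nat. D" ..
  show ?thesis by (subst product_nn_integral_prod) auto
qed

lemma nn_integral_PiM_sum:
  fixes h :: "'a \<Rightarrow> ennreal"
  assumes "prob_space D" and [measurable]: "h \<in> borel_measurable D"
  shows "(\<integral>\<^sup>+x. (\<Sum>i<n. h (x i)) \<partial>Pi\<^sub>M {..<n} (\<lambda>_. D)) = of_nat n * (\<integral>\<^sup>+z. h z \<partial>D)"
proof -
  have "(\<integral>\<^sup>+x. h (x i) \<partial>Pi\<^sub>M {..<n} (\<lambda>_. D)) = (\<integral>\<^sup>+z. h z \<partial>D)" if "i < n" for i
  proof -
    have "(\<integral>\<^sup>+z. h z \<partial>distr (Pi\<^sub>M {..<n} (\<lambda>_. D)) D (\<lambda>x. x i)) = (\<integral>\<^sup>+x. h (x i) \<partial>Pi\<^sub>M {..<n} (\<lambda>_. D))"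
      using that by (intro nn_integral_distr) auto
    thus ?thesis using that assms(1) distr_PiM_component[of "{..<n}" "\<lambda>_. D" i] by simp
  qed
  thus ?thesis by (subst nn_integral_sum) auto
qed

text \<open>By independence the centred sum has variance proxy \<open>n * \<sigma>\<^sup>2\<close>, and the variance proxy bounds the second
moment with constant one, so that the leading term \<open>\<sigma>\<^sup>2 / n\<close> has the right constant.\<close>
lemma sample_mean_square_error:
  assumes D: "prob_space D" and sets [measurable_cong]: "sets D = sets borel" and "0 < \<sigma>" and n: "1 \<le> n"
    and mgf: "\<And>u. (\<integral>\<^sup>+x. ennreal (exp (u * (x - \<mu>))) \<partial>D) \<le> ennreal (exp (u\<^sup>2 * \<sigma>\<^sup>2 / 2))"
  shows "(\<integral>\<^sup>+x. ennreal (((\<Sum>i<n. x i) / real n - \<mu>)\<^sup>2) \<partial>Pi\<^sub>M {..<n} (\<lambda>_. D)) \<le> ennreal (\<sigma>\<^sup>2 / real n)"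
proof -
  let ?P = "Pi\<^sub>M {..<n} (\<lambda>_. D)"
  interpret P: prob_space ?P using D by (intro prob_space_PiM)
  define Z where "Z = (\<lambda>x::nat \<Rightarrow> real. \<Sum>i<n. x i - \<mu>)"
  have [measurable]: "Z \<in> borel_measurable ?P" unfolding Z_def by measurable
  have "(\<integral>\<^sup>+x. ennreal ((Z x)\<^sup>2) \<partial>?P) \<le> ennreal (real n * \<sigma>\<^sup>2)"
  proof (rule P.subgaussian_mgf_moments(3))
    fix u :: real
    have "(\<integral>\<^sup>+x. ennreal (exp (u * Z x)) \<partial>?P) = (\<integral>\<^sup>+x. (\<Prod>i<n. ennreal (exp (u * (x i - \<mu>)))) \<partial>?P)"
      by (simp add: Z_def sum_distrib_left exp_sum prod_ennreal)
    also have "\<dots> = (\<integral>\<^sup>+z. ennreal (exp (u * (z - \<mu>))) \<partial>D) ^ n"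
      using D by (intro nn_integral_PiM_prod) auto
    also have "\<dots> \<le> ennreal (exp (u\<^sup>2 * \<sigma>\<^sup>2 / 2)) ^ n" by (intro power_mono mgf) auto
    also have "\<dots> = ennreal (exp (u\<^sup>2 * (real n * \<sigma>\<^sup>2) / 2))"
      by (simp add: ennreal_power mult_ac flip: exp_of_nat_mult)
    finally show "(\<integral>\<^sup>+x. ennreal (exp (u * Z x)) \<partial>?P) \<le> ennreal (exp (u\<^sup>2 * (real n * \<sigma>\<^sup>2) / 2))" .
  qed (use n \<open>0 < \<sigma>\<close> in auto)
  hence "ennreal (1 / (real n)\<^sup>2) * (\<integral>\<^sup>+x. ennreal ((Z x)\<^sup>2) \<partial>?P) \<le> ennreal (1 / (real n)\<^sup>2) * ennreal (real n * \<sigma>\<^sup>2)"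
    by (intro mult_left_mono) auto
  also have "\<dots> = ennreal (\<sigma>\<^sup>2 / real n)"
    using n by (simp add: power2_eq_square flip: ennreal_mult)
  also have "ennreal (1 / (real n)\<^sup>2) * (\<integral>\<^sup>+x. ennreal ((Z x)\<^sup>2) \<partial>?P)
      = (\<integral>\<^sup>+x. ennreal (((\<Sum>i<n. x i) / real n - \<mu>)\<^sup>2) \<partial>?P)"
  proof -
    have "(\<Sum>i<n. x i) / real n - \<mu> = Z x / real n" for x :: "nat \<Rightarrow> real"
      using n by (simp add: Z_def sum_subtractf field_simps)
    thus ?thesis
      by (subst nn_integral_cmult[symmetric]) (auto simp: power_divide simp flip: ennreal_mult)
  qed
  finally show ?thesis .
qed

text \<open>The Chernoff bound before integration. With \<open>r = l * t\<close> it dominates the indicator of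
\<open>t * \<sigma> \<le> \<bar>z - \<mu>\<bar>\<close>. A smaller \<open>r\<close> makes the value large when \<open>z\<close> is a deviation, so that a product of
such factors exceeds 1 as soon as a fixed fraction of the samples deviates. Using these functions
in place of events keeps the error estimate pointwise in the sample.\<close>
definition tail_bound :: "real \<Rightarrow> real \<Rightarrow> real \<Rightarrow> real \<Rightarrow> real \<Rightarrow> real" where
  "tail_bound \<sigma> \<mu> r l z = exp (- r) * (exp (l * (z - \<mu>) / \<sigma>) + exp (- (l * (z - \<mu>) / \<sigma>)))"

lemma measurable_tail_bound [measurable]: "tail_bound \<sigma> \<mu> r l \<in> borel_measurable borel"
  unfolding tail_bound_def by measurable

lemma tail_bound_pos: "0 < tail_bound \<sigma> \<mu> r l z"
  unfolding tail_bound_def by (intro mult_pos_pos add_pos_pos) auto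

lemma tail_bound_ge:
  assumes "0 < \<sigma>" "0 \<le> l" "t * \<sigma> \<le> \<bar>z - \<mu>\<bar>"
  shows "exp (l * t - r) \<le> tail_bound \<sigma> \<mu> r l z"
proof -
  define d where "d = l * (z - \<mu>) / \<sigma>"
  have "t \<le> \<bar>z - \<mu>\<bar> / \<sigma>" using assms by (simp add: field_simps)
  hence "l * t \<le> l * (\<bar>z - \<mu>\<bar> / \<sigma>)" using \<open>0 \<le> l\<close> by (rule mult_left_mono)
  also have "\<dots> = \<bar>d\<bar>" using assms by (simp add: d_def abs_mult)
  finally have "exp (l * t) \<le> exp \<bar>d\<bar>" by simp
  also have "\<dots> \<le> exp d + exp (- d)" by (cases "d \<ge> 0") auto
  finally have "exp (- r) * exp (l * t) \<le> exp (- r) * (exp d + exp (- d))" by simp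
  thus ?thesis by (simp add: tail_bound_def d_def exp_diff exp_minus field_simps)
qed

lemma tail_bound_ge_2: "2 * exp (- r) \<le> tail_bound \<sigma> \<mu> r l z"
proof -
  have "1 \<le> cosh (l * (z - \<mu>) / \<sigma>)" by (rule cosh_real_ge_1)
  hence "2 \<le> exp (l * (z - \<mu>) / \<sigma>) + exp (- (l * (z - \<mu>) / \<sigma>))" by (simp add: cosh_def)
  hence "exp (- r) * 2 \<le> exp (- r) * (exp (l * (z - \<mu>) / \<sigma>) + exp (- (l * (z - \<mu>) / \<sigma>)))"
    by (intro mult_left_mono) auto
  thus ?thesis by (simp add: tail_bound_def mult.commute)
qed

lemma nn_integral_tail_bound:
  assumes sets [measurable_cong]: "sets D = sets borel" and "0 < \<sigma>"
    and mgf: "\<And>u. (\<integral>\<^sup>+x. ennreal (exp (u * (x - \<mu>))) \<partial>D) \<le> ennreal (exp (u\<^sup>2 * \<sigma>\<^sup>2 / 2))"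
  shows "(\<integral>\<^sup>+z. ennreal (tail_bound \<sigma> \<mu> r l z) \<partial>D) \<le> ennreal (2 * exp (l\<^sup>2 / 2 - r))"
proof -
  have "(\<integral>\<^sup>+z. ennreal (tail_bound \<sigma> \<mu> r l z) \<partial>D)
     = (\<integral>\<^sup>+z. ennreal (exp (- r)) * (ennreal (exp (l / \<sigma> * (z - \<mu>))) + ennreal (exp (- l / \<sigma> * (z - \<mu>)))) \<partial>D)"
    by (intro nn_integral_cong) (simp add: tail_bound_def ennreal_mult flip: ennreal_plus)
  also have "\<dots> = ennreal (exp (- r)) * ((\<integral>\<^sup>+z. ennreal (exp (l / \<sigma> * (z - \<mu>))) \<partial>D) + (\<integral>\<^sup>+z. ennreal (exp (- l / \<sigma> * (z - \<mu>))) \<partial>D))"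
    by (simp add: nn_integral_cmult nn_integral_add)
  also have "\<dots> \<le> ennreal (exp (- r)) * (ennreal (exp ((l / \<sigma>)\<^sup>2 * \<sigma>\<^sup>2 / 2)) + ennreal (exp ((- l / \<sigma>)\<^sup>2 * \<sigma>\<^sup>2 / 2)))"
    by (intro mult_left_mono add_mono mgf) auto
  also have "\<dots> = ennreal (2 * exp (l\<^sup>2 / 2 - r))"
  proof -
    have "ennreal (exp (- r)) * (ennreal (exp ((l / \<sigma>)\<^sup>2 * \<sigma>\<^sup>2 / 2)) + ennreal (exp ((- l / \<sigma>)\<^sup>2 * \<sigma>\<^sup>2 / 2)))
      = ennreal (exp (- r) * (2 * exp (l\<^sup>2 / 2)))"
      using \<open>0 < \<sigma>\<close> by (simp add: power_divide flip: ennreal_plus ennreal_mult)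
    also have "exp (- r) * (2 * exp (l\<^sup>2 / 2)) = 2 * exp (l\<^sup>2 / 2 - r)"
      using mult_exp_exp[of "- r" "l\<^sup>2 / 2"] by (simp add: mult.left_commute)
    finally show ?thesis .
  qed
  finally show ?thesis .
qed

section \<open>Selecting a location and averaging\<close>

definition clamp_around :: "real \<Rightarrow> real \<Rightarrow> real \<Rightarrow> real" where
  "clamp_around c r z = max (c - r) (min (c + r) z)"

lemma measurable_clamp_around [measurable]: "clamp_around c r \<in> borel_measurable borel"
  unfolding clamp_around_def by measurable

lemma clamp_around_dist: "0 \<le> r \<Longrightarrow> \<bar>clamp_around c r z - c\<bar> \<le> r"
  by (auto simp: clamp_around_def)

lemma clamp_around_range: "0 \<le> r \<Longrightarrow> \<bar>clamp_around c r u - clamp_around c r v\<bar> \<le> 2 * r"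
  by (auto simp: clamp_around_def)

lemma clamp_around_id: "\<bar>z - c\<bar> \<le> r \<Longrightarrow> clamp_around c r z = z"
  by (auto simp: clamp_around_def)

definition grid :: "real \<Rightarrow> real \<Rightarrow> nat \<Rightarrow> real" where
  "grid a h g = a + h * real g"

lemma grid_nearby:
  assumes "0 < h" "a \<le> m" "m < a + h * real K"
  obtains j where "j < K" "\<bar>m - grid a h j\<bar> \<le> h"
proof -
  define j where "j = nat \<lfloor>(m - a) / h\<rfloor>"
  have 0: "0 \<le> (m - a) / h" using assms by simp
  have j: "real j = of_int \<lfloor>(m - a) / h\<rfloor>" using 0 by (simp add: j_def)
  have "real j \<le> (m - a) / h" "(m - a) / h < real j + 1" unfolding j by linarith+
  hence "h * real j \<le> m - a" "m - a < h * real j + h" using assms by (simp_all add: field_simps)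
  moreover have "h * real j < h * real K" using assms calculation by linarith
  ultimately show ?thesis using assms that[of j] by (simp add: grid_def)
qed

lemma grid_diff_le:
  assumes "0 < h" "a \<le> m" "m < a + h * real K" "g < K"
  shows "\<bar>grid a h g - m\<bar> \<le> h * real K"
proof -
  have "h * real g \<le> h * real K" "0 \<le> h * real g" using assms by simp_all
  thus ?thesis using assms unfolding grid_def abs_le_iff by linarith
qed

text \<open>The score of the grid point \<open>g\<close>. The radius exceeds \<open>t * \<sigma>\<close> by one grid spacing, so that the grid
point next to \<open>\<mu>\<close> counts every sample within \<open>t * \<sigma>\<close> of \<open>\<mu>\<close>.\<close>
definition window_count :: "nat \<Rightarrow> real \<Rightarrow> real \<Rightarrow> real \<Rightarrow> (nat \<Rightarrow> real) \<Rightarrow> nat \<Rightarrow> real" where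
  "window_count n a \<sigma> t x g = (\<Sum>i<n. if \<bar>x i - grid a \<sigma> g\<bar> \<le> (t + 1) * \<sigma> then 1 else 0)"

definition clamped_mean :: "nat \<Rightarrow> real \<Rightarrow> real \<Rightarrow> real \<Rightarrow> (nat \<Rightarrow> real) \<Rightarrow> nat \<Rightarrow> real" where
  "clamped_mean n a \<sigma> r x g = (\<Sum>i<n. clamp_around (grid a \<sigma> g) r (x i)) / real n"

lemma window_count_sensitivity:
  assumes "card {i \<in> {..<n}. x i \<noteq> y i} \<le> 1"
  shows "\<bar>window_count n a \<sigma> t x g - window_count n a \<sigma> t y g\<bar> \<le> 1"
  unfolding window_count_def
  using abs_sum_diff_le_range[OF assms, of "\<lambda>z. if \<bar>z - grid a \<sigma> g\<bar> \<le> (t + 1) * \<sigma> then 1 else 0" 1] by simp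

lemma clamped_mean_sensitivity:
  assumes "card {i \<in> {..<n}. x i \<noteq> y i} \<le> 1" "0 \<le> r"
  shows "\<bar>clamped_mean n a \<sigma> r x g - clamped_mean n a \<sigma> r y g\<bar> \<le> 2 * r / real n"
proof -
  have "\<bar>(\<Sum>i<n. clamp_around (grid a \<sigma> g) r (x i)) - (\<Sum>i<n. clamp_around (grid a \<sigma> g) r (y i))\<bar> \<le> 2 * r"
    by (intro abs_sum_diff_le_range[OF assms(1)] clamp_around_range assms(2))
  thus ?thesis
    unfolding clamped_mean_def diff_divide_distrib[symmetric] abs_divide by (simp add: divide_right_mono)
qed

lemma clamped_mean_dist:
  assumes "0 \<le> r" "1 \<le> n"
  shows "\<bar>clamped_mean n a \<sigma> r x g - grid a \<sigma> g\<bar> \<le> r"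
proof -
  have "\<bar>\<Sum>i<n. clamp_around (grid a \<sigma> g) r (x i) - grid a \<sigma> g\<bar> \<le> (\<Sum>i<n. r)"
    by (rule order_trans[OF sum_abs]) (intro sum_mono clamp_around_dist assms)
  moreover have "(\<Sum>i<n. clamp_around (grid a \<sigma> g) r (x i) - grid a \<sigma> g)
      = (clamped_mean n a \<sigma> r x g - grid a \<sigma> g) * real n"
    using assms by (simp add: clamped_mean_def sum_subtractf field_simps)
  ultimately have "\<bar>clamped_mean n a \<sigma> r x g - grid a \<sigma> g\<bar> * real n \<le> r * real n"
    by (simp add: abs_mult mult.commute)
  thus ?thesis using assms by simp
qed

lemma power2_le_of_abs_le: "\<bar>v\<bar> \<le> u \<Longrightarrow> v\<^sup>2 \<le> (u::real)\<^sup>2"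
  using power_mono[of "\<bar>v\<bar>" u 2] by simp

text \<open>Let \<open>B\<close> be the set of samples farther than \<open>t * \<sigma>\<close> from \<open>\<mu>\<close>, and call a grid point near if it is within
\<open>(2 * t + 1) * \<sigma>\<close> of \<open>\<mu>\<close>. Only samples in \<open>B\<close> are counted by a point that is not near, while all
others are counted by a grid point next to \<open>\<mu>\<close>. The four terms on the right answer, in this order: the
near points when \<open>B\<close> is empty; the near points when \<open>B\<close> is not empty (the sum is then at least 1); any
points when \<open>B\<close> contains more than a quarter of the samples (the product is then at least 1); and
the points that are not near otherwise.\<close>
lemma selected_clamped_mean_error:
  fixes x :: "nat \<Rightarrow> real"
  assumes \<sigma>: "0 < \<sigma>" and t: "1 \<le> t" and n: "1 \<le> n" and \<eta>: "0 \<le> \<eta>" and \<mu>: "a \<le> \<mu>" "\<mu> < a + \<sigma> * real K"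
  defines "r \<equiv> (3 * t + 1) * \<sigma>"
  shows "(\<Sum>g<K. exp_weight K \<eta> (window_count n a \<sigma> t x) g * (clamped_mean n a \<sigma> r x g - \<mu>)\<^sup>2)
    \<le> ((\<Sum>i<n. x i) / real n - \<mu>)\<^sup>2
      + ((5 * t + 2) * \<sigma>)\<^sup>2 * (\<Sum>i<n. tail_bound \<sigma> \<mu> (t\<^sup>2) t (x i))
      + (\<sigma> * real K + r)\<^sup>2 * (\<Prod>i<n. tail_bound \<sigma> \<mu> (t\<^sup>2 / 16) (t / 4) (x i))
      + (\<sigma> * real K + r)\<^sup>2 * (real K * exp (- (\<eta> * (real n / 2))))"
    (is "?lhs \<le> ?m + ?c1 * ?H + ?W * ?P + ?W * ?E")
proof -
  define B where "B = {i \<in> {..<n}. t * \<sigma> < \<bar>x i - \<mu>\<bar>}"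
  have fin: "finite B" and Bn: "B \<subseteq> {..<n}" by (auto simp: B_def)
  have card_B: "(\<Sum>i<n. if i \<in> B then 1 else 0) = real (card B)"
    using Bn by (simp add: Int_absorb1 flip: sum.inter_restrict)
  have r: "0 \<le> r" unfolding r_def using \<sigma> t by simp
  obtain j where j: "j < K" "\<bar>\<mu> - grid a \<sigma> j\<bar> \<le> \<sigma>" using grid_nearby[OF \<sigma> \<mu>] .
  have H0: "0 \<le> ?H" by (intro sum_nonneg less_imp_le tail_bound_pos)
  have P0: "0 \<le> ?P" by (intro prod_nonneg less_imp_le tail_bound_pos)
  have W: "(clamped_mean n a \<sigma> r x g - \<mu>)\<^sup>2 \<le> ?W" if "g < K" for g
    using clamped_mean_dist[OF r n, of a \<sigma> x g] grid_diff_le[OF \<sigma> \<mu> that] r \<sigma>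
    by (intro power2_le_of_abs_le) auto
  show ?thesis
  proof (cases "4 * real (card B) \<le> real n")
    case True
    let ?Good = "{g. \<bar>grid a \<sigma> g - \<mu>\<bar> \<le> (2 * t + 1) * \<sigma>}"
    have "?lhs \<le> (?m + ?c1 * ?H) + ?W * ?E"
    proof (rule weighted_sum_le_gap[OF j(1), where Good = ?Good])
      fix g assume g: "g < K" "g \<notin> ?Good"
      have 1: "window_count n a \<sigma> t x g \<le> real (card B)"
        unfolding window_count_def card_B[symmetric]
      proof (intro sum_mono)
        fix i assume "i \<in> {..<n}"
        moreover have "t * \<sigma> < \<bar>x i - \<mu>\<bar>" if "\<bar>x i - grid a \<sigma> g\<bar> \<le> (t + 1) * \<sigma>"
        proof -
          have "(2 * t + 1) * \<sigma> < \<bar>grid a \<sigma> g - \<mu>\<bar>" using g by simp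
          moreover have "(2 * t + 1) * \<sigma> = (t + 1) * \<sigma> + t * \<sigma>" by (simp add: algebra_simps)
          ultimately show ?thesis using that by linarith
        qed
        ultimately show "(if \<bar>x i - grid a \<sigma> g\<bar> \<le> (t + 1) * \<sigma> then 1 else 0) \<le> (if i \<in> B then 1 else (0::real))"
          by (auto simp: B_def)
      qed
      have "real n - real (card B) = (\<Sum>i<n. if i \<in> B then 0 else 1)"
      proof -
        have "(\<Sum>i<n. if i \<in> B then 0 else (1::real)) = (\<Sum>i<n. 1 - (if i \<in> B then 1 else 0))"
          by (intro sum.cong) auto
        thus ?thesis by (simp add: sum_subtractf card_B)
      qed
      also have "\<dots> \<le> window_count n a \<sigma> t x j"
        unfolding window_count_def
      proof (intro sum_mono)
        fix i assume i: "i \<in> {..<n}"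
        have "\<bar>x i - grid a \<sigma> j\<bar> \<le> (t + 1) * \<sigma>" if "i \<notin> B"
        proof -
          have "\<bar>x i - \<mu>\<bar> \<le> t * \<sigma>" using that i by (simp add: B_def)
          thus ?thesis using j(2) by (simp add: algebra_simps)
        qed
        thus "(if i \<in> B then 0 else (1::real)) \<le> (if \<bar>x i - grid a \<sigma> j\<bar> \<le> (t + 1) * \<sigma> then 1 else 0)" by auto
      qed
      finally show "window_count n a \<sigma> t x g + real n / 2 \<le> window_count n a \<sigma> t x j"
        using 1 True by linarith
    next
      fix g assume g: "g < K" "g \<in> ?Good"
      show "(clamped_mean n a \<sigma> r x g - \<mu>)\<^sup>2 \<le> ?m + ?c1 * ?H"
      proof (cases "B = {}")
        case True
        have "clamp_around (grid a \<sigma> g) r (x i) = x i" if i: "i < n" for i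
        proof (rule clamp_around_id)
          have "\<bar>x i - \<mu>\<bar> \<le> t * \<sigma>" using True i by (auto simp: B_def)
          moreover have "\<bar>grid a \<sigma> g - \<mu>\<bar> \<le> (2 * t + 1) * \<sigma>" using g by simp
          moreover have "t * \<sigma> + (2 * t + 1) * \<sigma> = r" by (simp add: r_def algebra_simps)
          ultimately show "\<bar>x i - grid a \<sigma> g\<bar> \<le> r" by linarith
        qed
        hence "clamped_mean n a \<sigma> r x g = (\<Sum>i<n. x i) / real n" by (simp add: clamped_mean_def)
        thus ?thesis using H0 by simp
      next
        case False
        then obtain i where i: "i < n" "t * \<sigma> < \<bar>x i - \<mu>\<bar>" by (auto simp: B_def)
        have "1 \<le> tail_bound \<sigma> \<mu> (t\<^sup>2) t (x i)"
          using tail_bound_ge[OF \<sigma>, of t t "x i" \<mu> "t\<^sup>2"] t i by (simp add: power2_eq_square)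
        also have "\<dots> \<le> ?H"
          using i by (intro member_le_sum) (auto intro: less_imp_le[OF tail_bound_pos])
        finally have H1: "1 \<le> ?H" .
        have "\<bar>grid a \<sigma> g - \<mu>\<bar> \<le> (2 * t + 1) * \<sigma>" using g by simp
        moreover have "r + (2 * t + 1) * \<sigma> = (5 * t + 2) * \<sigma>" by (simp add: r_def algebra_simps)
        ultimately have "\<bar>clamped_mean n a \<sigma> r x g - \<mu>\<bar> \<le> (5 * t + 2) * \<sigma>"
          using clamped_mean_dist[OF r n, of a \<sigma> x g] by linarith
        hence "(clamped_mean n a \<sigma> r x g - \<mu>)\<^sup>2 \<le> ?c1"
          using t \<sigma> by (intro power2_le_of_abs_le) auto
        also have "\<dots> \<le> ?c1 * ?H" using mult_left_mono[OF H1, of ?c1] by simp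
        finally show ?thesis by (simp add: add_increasing)
      qed
    qed (use \<eta> W H0 in auto)
    moreover have "0 \<le> ?W * ?P" using P0 by simp
    ultimately show ?thesis by linarith
  next
    case False
    have "?lhs \<le> ?W + 0 * (real K * exp (- (\<eta> * 0)))"
      by (rule weighted_sum_le_gap[OF j(1), where Good = UNIV]) (use \<eta> W in auto)
    moreover have "1 \<le> ?P"
    proof -
      have "t\<^sup>2 / 4 * (real n / 4) \<le> t\<^sup>2 / 4 * real (card B)" using False by (intro mult_left_mono) auto
      hence "1 \<le> exp (t\<^sup>2 / 4 * real (card B) - t\<^sup>2 / 16 * real n)" by simp
      also have "\<dots> = exp (\<Sum>i<n. t\<^sup>2 / 4 * (if i \<in> B then 1 else 0) - t\<^sup>2 / 16)"
        unfolding sum_subtractf sum_distrib_left[symmetric] card_B by (simp add: mult.commute)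
      also have "\<dots> = (\<Prod>i<n. exp (t\<^sup>2 / 4 * (if i \<in> B then 1 else 0) - t\<^sup>2 / 16))"
        by (rule exp_sum) simp
      also have "\<dots> \<le> ?P"
      proof (intro prod_mono conjI)
        fix i
        show "exp (t\<^sup>2 / 4 * (if i \<in> B then 1 else 0) - t\<^sup>2 / 16) \<le> tail_bound \<sigma> \<mu> (t\<^sup>2 / 16) (t / 4) (x i)"
        proof (cases "i \<in> B")
          case True
          thus ?thesis using tail_bound_ge[OF \<sigma>, of "t / 4" t "x i" \<mu> "t\<^sup>2 / 16"] t
            by (simp add: B_def power2_eq_square)
        next
          case False
          have "exp (- (t\<^sup>2 / 16)) \<le> 2 * exp (- (t\<^sup>2 / 16))" by simp
          also have "\<dots> \<le> tail_bound \<sigma> \<mu> (t\<^sup>2 / 16) (t / 4) (x i)" by (rule tail_bound_ge_2)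
          finally show ?thesis using False by simp
        qed
      qed simp
      finally show ?thesis .
    qed
    hence "?W \<le> ?W * ?P" using mult_left_mono[of 1 ?P ?W] by simp
    moreover have "0 \<le> ?m" "0 \<le> ?c1 * ?H" "0 \<le> ?W * ?E" using H0 by auto
    ultimately show ?thesis by linarith
  qed
qed

definition truncated_mean :: "nat \<Rightarrow> real \<Rightarrow> real \<Rightarrow> (nat \<Rightarrow> real) \<Rightarrow> real" where
  "truncated_mean n a b x = max a (min b ((\<Sum>i<n. x i) / real n))"

text \<open>Here the score only says whether the truncated sample mean \<open>m\<close> is within one spacing of the grid
point; where it is, clamping does not change \<open>m\<close>, so the rounding causes no bias. Truncation to an
interval that contains \<open>\<mu>\<close> does not increase the distance to \<open>\<mu>\<close>.\<close>
lemma selected_truncated_mean_error: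
  fixes x :: "nat \<Rightarrow> real"
  assumes h: "0 < h" and \<eta>: "0 \<le> \<eta>" and \<mu>: "a \<le> \<mu>" "\<mu> \<le> b" and b: "b < a + h * real K"
  shows "(\<Sum>g<K. exp_weight K \<eta> (\<lambda>g. if \<bar>truncated_mean n a b x - grid a h g\<bar> \<le> h then 1 else 0) g
           * (clamp_around (grid a h g) h (truncated_mean n a b x) - \<mu>)\<^sup>2)
    \<le> ((\<Sum>i<n. x i) / real n - \<mu>)\<^sup>2 + (h * real K + h)\<^sup>2 * (real K * exp (- \<eta>))"
proof -
  define m where "m = truncated_mean n a b x"
  have m: "a \<le> m" "m \<le> b" using \<mu> by (auto simp: m_def truncated_mean_def)
  obtain j where j: "j < K" "\<bar>m - grid a h j\<bar> \<le> h"
    using grid_nearby[OF h m(1), of K] m b by auto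
  have contract: "\<bar>m - \<mu>\<bar> \<le> \<bar>(\<Sum>i<n. x i) / real n - \<mu>\<bar>"
    using \<mu> by (auto simp: m_def truncated_mean_def)
  have "(\<Sum>g<K. exp_weight K \<eta> (\<lambda>g. if \<bar>m - grid a h g\<bar> \<le> h then 1 else 0) g * (clamp_around (grid a h g) h m - \<mu>)\<^sup>2)
    \<le> ((\<Sum>i<n. x i) / real n - \<mu>)\<^sup>2 + (h * real K + h)\<^sup>2 * (real K * exp (- (\<eta> * 1)))"
  proof (rule weighted_sum_le_gap[OF j(1), where Good = "{g. \<bar>m - grid a h g\<bar> \<le> h}"])
    fix g assume g: "g < K" "g \<in> {g. \<bar>m - grid a h g\<bar> \<le> h}"
    hence "clamp_around (grid a h g) h m = m" by (intro clamp_around_id) auto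
    thus "(clamp_around (grid a h g) h m - \<mu>)\<^sup>2 \<le> ((\<Sum>i<n. x i) / real n - \<mu>)\<^sup>2"
      using contract by (simp add: abs_le_square_iff)
  next
    fix g assume "g < K"
    hence "\<bar>grid a h g - \<mu>\<bar> \<le> h * real K" using h \<mu> b by (intro grid_diff_le) auto
    thus "(clamp_around (grid a h g) h m - \<mu>)\<^sup>2 \<le> (h * real K + h)\<^sup>2"
      using clamp_around_dist[of h "grid a h g" m] h by (intro power2_le_of_abs_le) auto
  qed (use j \<eta> in auto)
  thus ?thesis by (simp add: m_def)
qed

section \<open>Integrating over the sample\<close>

text \<open>The pointwise estimates only involve the sample mean, a sum and a product over the samples, and
constants. The parameters of the two majorants are chosen so that they integrate to
\<open>2 * exp (- (t\<^sup>2 / 2))\<close> and \<open>2 * exp (- (t\<^sup>2 / 32))\<close>.\<close>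
lemma expected_error_gaussian_mixture:
  assumes D: "prob_space D" and sets [measurable_cong]: "sets D = sets borel" and \<sigma>: "0 < \<sigma>" and n: "1 \<le> n"
    and mgf: "\<And>u. (\<integral>\<^sup>+x. ennreal (exp (u * (x - \<mu>))) \<partial>D) \<le> ennreal (exp (u\<^sup>2 * \<sigma>\<^sup>2 / 2))"
    and K: "0 < K" and s: "0 < s" and c: "0 \<le> c\<^sub>1" "0 \<le> c\<^sub>2" "0 \<le> c\<^sub>3"
    and le: "\<And>x. (\<Sum>g<K. exp_weight K \<eta> (q x) g * (f x g - \<mu>)\<^sup>2)
      \<le> ((\<Sum>i<n. x i) / real n - \<mu>)\<^sup>2 + c\<^sub>1 * (\<Sum>i<n. tail_bound \<sigma> \<mu> (t\<^sup>2) t (x i))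
        + c\<^sub>2 * (\<Prod>i<n. tail_bound \<sigma> \<mu> (t\<^sup>2 / 16) (t / 4) (x i)) + c\<^sub>3"
  shows "(\<integral>\<^sup>+x. (\<integral>\<^sup>+y. ennreal ((y - \<mu>)\<^sup>2) \<partial>gaussian_mixture K \<eta> s (q x) (f x)) \<partial>Pi\<^sub>M {..<n} (\<lambda>_. D))
    \<le> ennreal (\<sigma>\<^sup>2 / real n + c\<^sub>1 * (real n * (2 * exp (- (t\<^sup>2 / 2)))) + c\<^sub>2 * (2 * exp (- (t\<^sup>2 / 32))) ^ n + c\<^sub>3 + s\<^sup>2)"
proof -
  let ?P = "Pi\<^sub>M {..<n} (\<lambda>_. D)"
  interpret P: prob_space ?P using D by (intro prob_space_PiM)
  let ?m = "\<lambda>x::nat \<Rightarrow> real. ((\<Sum>i<n. x i) / real n - \<mu>)\<^sup>2"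
  let ?H = "tail_bound \<sigma> \<mu> (t\<^sup>2) t" and ?h = "tail_bound \<sigma> \<mu> (t\<^sup>2 / 16) (t / 4)"
  have pos: "0 \<le> ?H z" "0 \<le> ?h z" for z by (simp_all add: tail_bound_pos less_imp_le)
  have "(\<integral>\<^sup>+x. (\<integral>\<^sup>+y. ennreal ((y - \<mu>)\<^sup>2) \<partial>gaussian_mixture K \<eta> s (q x) (f x)) \<partial>?P)
    \<le> (\<integral>\<^sup>+x. ennreal (?m x) + ennreal c\<^sub>1 * (\<Sum>i<n. ennreal (?H (x i)))
        + ennreal c\<^sub>2 * (\<Prod>i<n. ennreal (?h (x i))) + ennreal (c\<^sub>3 + s\<^sup>2) \<partial>?P)"
  proof (intro nn_integral_mono)
    fix x
    have "(\<integral>\<^sup>+y. ennreal ((y - \<mu>)\<^sup>2) \<partial>gaussian_mixture K \<eta> s (q x) (f x))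
      \<le> ennreal (?m x + c\<^sub>1 * (\<Sum>i<n. ?H (x i)) + c\<^sub>2 * (\<Prod>i<n. ?h (x i)) + (c\<^sub>3 + s\<^sup>2))"
      unfolding gaussian_mixture_mean_square_error[OF K s] using le[of x] by (intro ennreal_leI) simp
    also have "\<dots> = ennreal (?m x) + ennreal (c\<^sub>1 * (\<Sum>i<n. ?H (x i))) + ennreal (c\<^sub>2 * (\<Prod>i<n. ?h (x i))) + ennreal (c\<^sub>3 + s\<^sup>2)"
      using c pos by (simp add: ennreal_plus sum_nonneg prod_nonneg del: ennreal_plus[symmetric])
    also have "\<dots> = ennreal (?m x) + ennreal c\<^sub>1 * (\<Sum>i<n. ennreal (?H (x i)))
        + ennreal c\<^sub>2 * (\<Prod>i<n. ennreal (?h (x i))) + ennreal (c\<^sub>3 + s\<^sup>2)"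
      using c pos by (simp add: ennreal_mult sum_nonneg prod_nonneg sum_ennreal prod_ennreal)
    finally show "(\<integral>\<^sup>+y. ennreal ((y - \<mu>)\<^sup>2) \<partial>gaussian_mixture K \<eta> s (q x) (f x))
      \<le> ennreal (?m x) + ennreal c\<^sub>1 * (\<Sum>i<n. ennreal (?H (x i)))
        + ennreal c\<^sub>2 * (\<Prod>i<n. ennreal (?h (x i))) + ennreal (c\<^sub>3 + s\<^sup>2)" .
  qed
  also have "\<dots> = (\<integral>\<^sup>+x. ennreal (?m x) \<partial>?P) + ennreal c\<^sub>1 * (\<integral>\<^sup>+x. (\<Sum>i<n. ennreal (?H (x i))) \<partial>?P)
      + ennreal c\<^sub>2 * (\<integral>\<^sup>+x. (\<Prod>i<n. ennreal (?h (x i))) \<partial>?P) + ennreal (c\<^sub>3 + s\<^sup>2)"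
    by (simp add: nn_integral_add nn_integral_cmult P.emeasure_space_1)
  also have "\<dots> \<le> ennreal (\<sigma>\<^sup>2 / real n) + ennreal c\<^sub>1 * (of_nat n * ennreal (2 * exp (- (t\<^sup>2 / 2))))
      + ennreal c\<^sub>2 * ennreal (2 * exp (- (t\<^sup>2 / 32))) ^ n + ennreal (c\<^sub>3 + s\<^sup>2)"
  proof (intro add_mono mult_left_mono order_refl)
    show "(\<integral>\<^sup>+x. ennreal (?m x) \<partial>?P) \<le> ennreal (\<sigma>\<^sup>2 / real n)"
      by (rule sample_mean_square_error[OF D sets \<sigma> n mgf])
    have "(\<integral>\<^sup>+z. ennreal (?H z) \<partial>D) \<le> ennreal (2 * exp (t\<^sup>2 / 2 - t\<^sup>2))"
      by (rule nn_integral_tail_bound[OF sets \<sigma> mgf])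
    also have "t\<^sup>2 / 2 - t\<^sup>2 = - (t\<^sup>2 / 2)" by simp
    finally show "(\<integral>\<^sup>+x. (\<Sum>i<n. ennreal (?H (x i))) \<partial>?P) \<le> of_nat n * ennreal (2 * exp (- (t\<^sup>2 / 2)))"
      using nn_integral_PiM_sum[OF D, of "\<lambda>z. ennreal (?H z)" n] by (simp add: mult_left_mono)
    have "(\<integral>\<^sup>+z. ennreal (?h z) \<partial>D) \<le> ennreal (2 * exp ((t / 4)\<^sup>2 / 2 - t\<^sup>2 / 16))"
      by (rule nn_integral_tail_bound[OF sets \<sigma> mgf])
    also have "(t / 4)\<^sup>2 / 2 - t\<^sup>2 / 16 = - (t\<^sup>2 / 32)" by (simp add: power_divide)
    finally show "(\<integral>\<^sup>+x. (\<Prod>i<n. ennreal (?h (x i))) \<partial>?P) \<le> ennreal (2 * exp (- (t\<^sup>2 / 32))) ^ n"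
      using nn_integral_PiM_prod[OF D, of "\<lambda>z. ennreal (?h z)" n] by (simp add: power_mono)
  qed auto
  also have "\<dots> = ennreal (\<sigma>\<^sup>2 / real n + c\<^sub>1 * (real n * (2 * exp (- (t\<^sup>2 / 2)))) + c\<^sub>2 * (2 * exp (- (t\<^sup>2 / 32))) ^ n + c\<^sub>3 + s\<^sup>2)"
    using c by (simp add: ennreal_power ennreal_of_nat_eq_real_of_nat add.assoc flip: ennreal_mult ennreal_plus)
  finally show ?thesis .
qed

text \<open>Achievability of the mean squared error \<open>v\<close> by a private algorithm. As \<open>private_mean_bound\<close> is monotone
in \<open>v\<close>, each regime can state its own error and be compared with the target afterwards.\<close>
definition private_mean_bound :: "nat \<Rightarrow> real \<Rightarrow> real \<Rightarrow> real \<Rightarrow> real \<Rightarrow> real \<Rightarrow> bool" where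
  "private_mean_bound n \<epsilon> \<sigma> a b v \<longleftrightarrow>
    (\<exists>M. randomized_algorithm n M \<and> concentrated_DP n (1 / 2 * \<epsilon>\<^sup>2) M \<and>
      (\<forall>(D::real measure) (\<mu>::real).
        prob_space D \<longrightarrow> sets D = sets borel \<longrightarrow> subgaussian \<sigma> D \<longrightarrow>
        (\<integral>x. x \<partial>D) = \<mu> \<longrightarrow> \<mu> \<in> {a..b} \<longrightarrow>
        (\<integral>\<^sup>+x. (\<integral>\<^sup>+y. ennreal ((y - \<mu>)\<^sup>2) \<partial>M x) \<partial>(Pi\<^sub>M {..<n} (\<lambda>_. D))) \<le> ennreal v))"

lemma private_mean_bound_mono:
  "private_mean_bound n \<epsilon> \<sigma> a b v \<Longrightarrow> v \<le> w \<Longrightarrow> private_mean_bound n \<epsilon> \<sigma> a b w"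
  unfolding private_mean_bound_def by (meson ennreal_leI order_trans)

text \<open>What is left to check for a concrete choice of scores and centres: sensitivity, measurability, the
pointwise error estimate, and one numerical inequality.\<close>
lemma private_mean_boundI:
  assumes K: "0 < K" and s: "0 < s" and \<epsilon>: "0 < \<epsilon>" and \<sigma>: "0 < \<sigma>" and n: "1 \<le> n"
    and s\<Delta>: "2 * \<Delta> \<le> s * \<epsilon>" "0 \<le> \<Delta>" and c: "0 \<le> c\<^sub>1" "0 \<le> c\<^sub>2" "0 \<le> c\<^sub>3"
    and qm: "\<And>g. (\<lambda>x. q x g) \<in> borel_measurable (real_vec n)"
    and fm: "\<And>g. (\<lambda>x. f x g) \<in> borel_measurable (real_vec n)"
    and q: "\<And>x y g. card {i \<in> {..<n}. x i \<noteq> y i} \<le> 1 \<Longrightarrow> \<bar>q x g - q y g\<bar> \<le> 1"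
    and f: "\<And>x y g. card {i \<in> {..<n}. x i \<noteq> y i} \<le> 1 \<Longrightarrow> \<bar>f x g - f y g\<bar> \<le> \<Delta>"
    and le: "\<And>x \<mu>. a \<le> \<mu> \<Longrightarrow> \<mu> \<le> b \<Longrightarrow> (\<Sum>g<K. exp_weight K (\<epsilon> / 8) (q x) g * (f x g - \<mu>)\<^sup>2)
      \<le> ((\<Sum>i<n. x i) / real n - \<mu>)\<^sup>2 + c\<^sub>1 * (\<Sum>i<n. tail_bound \<sigma> \<mu> (t\<^sup>2) t (x i))
        + c\<^sub>2 * (\<Prod>i<n. tail_bound \<sigma> \<mu> (t\<^sup>2 / 16) (t / 4) (x i)) + c\<^sub>3"
    and v: "\<sigma>\<^sup>2 / real n + c\<^sub>1 * (real n * (2 * exp (- (t\<^sup>2 / 2)))) + c\<^sub>2 * (2 * exp (- (t\<^sup>2 / 32))) ^ n + c\<^sub>3 + s\<^sup>2 \<le> v"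
  shows "private_mean_bound n \<epsilon> \<sigma> a b v"
  unfolding private_mean_bound_def
proof (intro exI conjI allI impI)
  show "randomized_algorithm n (\<lambda>x. gaussian_mixture K (\<epsilon> / 8) s (q x) (f x))"
    by (rule randomized_algorithm_gaussian_mixture[OF K s qm fm])
  show "concentrated_DP n (1 / 2 * \<epsilon>\<^sup>2) (\<lambda>x. gaussian_mixture K (\<epsilon> / 8) s (q x) (f x))"
    by (rule concentrated_DP_gaussian_mixture[OF K \<epsilon> s s\<Delta> q f])
  fix D :: "real measure" and \<mu>
  assume D: "prob_space D" "sets D = sets borel" "subgaussian \<sigma> D" "(\<integral>x. x \<partial>D) = \<mu>" "\<mu> \<in> {a..b}"
  have "(\<integral>\<^sup>+x. ennreal (exp (u * (x - \<mu>))) \<partial>D) \<le> ennreal (exp (u\<^sup>2 * \<sigma>\<^sup>2 / 2))" for u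
    using subgaussian_about_mean[OF D(1-3) \<sigma>] D(4) by simp
  hence "(\<integral>\<^sup>+x. (\<integral>\<^sup>+y. ennreal ((y - \<mu>)\<^sup>2) \<partial>gaussian_mixture K (\<epsilon> / 8) s (q x) (f x)) \<partial>(Pi\<^sub>M {..<n} (\<lambda>_. D)))
    \<le> ennreal (\<sigma>\<^sup>2 / real n + c\<^sub>1 * (real n * (2 * exp (- (t\<^sup>2 / 2)))) + c\<^sub>2 * (2 * exp (- (t\<^sup>2 / 32))) ^ n + c\<^sub>3 + s\<^sup>2)"
    using D(5) by (intro expected_error_gaussian_mixture[OF D(1,2) \<sigma> n _ K s c le]) auto
  also have "\<dots> \<le> ennreal v" using v by (rule ennreal_leI)
  finally show "(\<integral>\<^sup>+x. (\<integral>\<^sup>+y. ennreal ((y - \<mu>)\<^sup>2) \<partial>gaussian_mixture K (\<epsilon> / 8) s (q x) (f x)) \<partial>(Pi\<^sub>M {..<n} (\<lambda>_. D))) \<le> ennreal v" .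
qed

section \<open>Three parameter regimes\<close>

lemma exp_minus_le_inverse_square: "0 < x \<Longrightarrow> exp (- x) \<le> 2 / (x::real)\<^sup>2"
proof -
  assume x: "0 < x"
  have "x\<^sup>2 / 2 \<le> exp x" using exp_lower_Taylor_quadratic[of x] x by simp
  thus ?thesis using x by (simp add: exp_minus field_simps)
qed

text \<open>Every term is at most a constant times \<open>Q = U * \<sigma>\<^sup>2 / N\<^sup>2\<close> with \<open>N = n * \<epsilon>\<close>. In the first term \<open>exp (- (32 * U))\<close> beats
\<open>n * N\<^sup>2\<close> because \<open>exp U\<close> exceeds both \<open>n\<close> and \<open>\<epsilon>\<close>. In the middle terms the squared range and the number
of grid points contribute a factor \<open>exp (3 * L)\<close>, and \<open>96 * L \<le> N\<close> leaves \<open>exp (- (N / 32))\<close>.\<close>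
lemma selection_error_numeric:
  fixes n K :: nat and \<epsilon> \<sigma> L :: real
  assumes n: "1 \<le> n" and \<epsilon>: "0 < \<epsilon>" and \<sigma>: "0 < \<sigma>" and L: "0 \<le> L" and N: "96 * L \<le> real n * \<epsilon>"
    and K: "real K \<le> 2 * exp L"
  defines "U \<equiv> ln (real n) + 1 + \<epsilon>"
  defines "t \<equiv> 8 * sqrt U"
  defines "r \<equiv> (3 * t + 1) * \<sigma>"
  shows "((5 * t + 2) * \<sigma>)\<^sup>2 * (real n * (2 * exp (- (t\<^sup>2 / 2))))
     + (\<sigma> * real K + r)\<^sup>2 * (2 * exp (- (t\<^sup>2 / 32))) ^ n
     + (\<sigma> * real K + r)\<^sup>2 * (real K * exp (- (\<epsilon> / 8 * (real n / 2))))
     + (4 * r / (real n * \<epsilon>))\<^sup>2 \<le> 10 ^ 7 * (U * \<sigma>\<^sup>2 / (real n * \<epsilon>)\<^sup>2)"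
proof -
  define N where "N = real n * \<epsilon>"
  define Q where "Q = U * \<sigma>\<^sup>2 / N\<^sup>2"
  have Npos: "0 < N" using n \<epsilon> by (simp add: N_def)
  have ln: "0 \<le> ln (real n)" using n by simp
  have U: "1 \<le> U" "\<epsilon> \<le> U" "ln (real n) \<le> U" using ln \<epsilon> by (auto simp: U_def)
  have t2: "t\<^sup>2 = 64 * U" using U by (simp add: t_def power_mult_distrib)
  have t: "8 \<le> t" using U by (simp add: t_def)
  have Q0: "0 \<le> Q" using U by (simp add: Q_def)

  have 1: "((5 * t + 2) * \<sigma>)\<^sup>2 * (real n * (2 * exp (- (t\<^sup>2 / 2)))) \<le> 4608 * Q"
  proof -
    have "((5 * t + 2) * \<sigma>)\<^sup>2 \<le> (6 * t * \<sigma>)\<^sup>2" using t \<sigma> by (intro power_mono) auto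
    also have "\<dots> = 2304 * (U * \<sigma>\<^sup>2)" by (simp add: power_mult_distrib t2)
    finally have sq: "((5 * t + 2) * \<sigma>)\<^sup>2 \<le> 2304 * (U * \<sigma>\<^sup>2)" .
    have "real n * N\<^sup>2 = real n ^ 3 * \<epsilon>\<^sup>2" by (simp add: N_def power_mult_distrib power2_eq_square power3_eq_cube)
    also have "\<dots> \<le> exp U ^ 3 * exp U ^ 2"
    proof (intro mult_mono power_mono)
      show "real n \<le> exp U" using U(3) n by (metis exp_le_cancel_iff exp_ln of_nat_0_less_iff zero_less_one order_less_le_trans)
      show "\<epsilon> \<le> exp U" using U(2) exp_ge_add_one_self[of U] by linarith
    qed (use \<epsilon> in auto)
    also have "\<dots> = exp (5 * U)" by (simp flip: exp_of_nat_mult exp_add)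
    also have "\<dots> \<le> exp (32 * U)" using U by simp
    finally have "real n * exp (- (32 * U)) \<le> 1 / N\<^sup>2"
      using Npos by (simp add: exp_minus field_simps)
    moreover have "t\<^sup>2 / 2 = 32 * U" using t2 by simp
    ultimately have "real n * (2 * exp (- (t\<^sup>2 / 2))) \<le> 2 / N\<^sup>2" by simp
    hence "((5 * t + 2) * \<sigma>)\<^sup>2 * (real n * (2 * exp (- (t\<^sup>2 / 2)))) \<le> 2304 * (U * \<sigma>\<^sup>2) * (2 / N\<^sup>2)"
      using sq U by (intro mult_mono) auto
    thus ?thesis by (simp add: Q_def)
  qed

  have r: "r \<le> 4 * t * \<sigma>" "0 \<le> r" using t \<sigma> by (auto simp: r_def)
  have 4: "(4 * r / N)\<^sup>2 \<le> 16384 * Q"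
  proof -
    have "(4 * r / N)\<^sup>2 \<le> (4 * (4 * t * \<sigma>) / N)\<^sup>2"
      using r Npos by (intro power_mono divide_right_mono mult_left_mono) auto
    also have "\<dots> = 16384 * Q" by (simp add: Q_def power_divide power_mult_distrib t2)
    finally show ?thesis .
  qed

  have W: "(\<sigma> * real K + r)\<^sup>2 \<le> 1600 * (U * \<sigma>\<^sup>2) * exp (2 * L)"
  proof -
    have "\<sigma> * real K \<le> \<sigma> * (2 * exp L)" using K \<sigma> by simp
    moreover have "4 * t * \<sigma> * 1 \<le> 4 * t * \<sigma> * exp L" using L t \<sigma> by (intro mult_left_mono) auto
    moreover have "2 * (\<sigma> * exp L) \<le> t * (\<sigma> * exp L)" using t \<sigma> by (intro mult_right_mono) auto
    ultimately have "\<sigma> * real K + r \<le> 5 * t * \<sigma> * exp L" using r by (simp add: algebra_simps)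
    hence "(\<sigma> * real K + r)\<^sup>2 \<le> (5 * t * \<sigma> * exp L)\<^sup>2" using r \<sigma> by (intro power_mono) auto
    also have "\<dots> = 1600 * (U * \<sigma>\<^sup>2) * exp (2 * L)"
      by (simp add: power_mult_distrib t2 exp_double)
    finally show ?thesis .
  qed
  have small: "(2 * exp (- (t\<^sup>2 / 32))) ^ n + real K * exp (- (\<epsilon> / 8 * (real n / 2))) \<le> 3 * exp (L - N / 16)"
  proof -
    have "2 * exp (- (t\<^sup>2 / 32)) \<le> exp (- \<epsilon>)"
    proof -
      have "(2::real) \<le> exp 1" using exp_ge_add_one_self[of 1] by simp
      hence "2 * exp (- (2 * U)) \<le> exp 1 * exp (- (2 * U))" by (intro mult_right_mono) auto
      also have "\<dots> = exp (1 - 2 * U)" by (simp flip: exp_add)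
      also have "\<dots> \<le> exp (- \<epsilon>)" using U by simp
      finally show ?thesis by (simp add: t2)
    qed
    hence "(2 * exp (- (t\<^sup>2 / 32))) ^ n \<le> exp (- \<epsilon>) ^ n" by (intro power_mono) auto
    also have "\<dots> = exp (- N)" by (simp add: N_def flip: exp_of_nat_mult)
    also have "\<dots> \<le> exp (L - N / 16)" using L Npos by simp
    finally have "(2 * exp (- (t\<^sup>2 / 32))) ^ n \<le> exp (L - N / 16)" .
    moreover have "real K * exp (- (\<epsilon> / 8 * (real n / 2))) \<le> 2 * exp L * exp (- (N / 16))"
      using K by (intro mult_mono) (auto simp: N_def)
    moreover have "exp L * exp (- (N / 16)) = exp (L - N / 16)" by (simp flip: exp_add)
    ultimately show ?thesis by simp
  qed
  have "(\<sigma> * real K + r)\<^sup>2 * ((2 * exp (- (t\<^sup>2 / 32))) ^ n + real K * exp (- (\<epsilon> / 8 * (real n / 2))))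
      \<le> (1600 * (U * \<sigma>\<^sup>2) * exp (2 * L)) * (3 * exp (L - N / 16))"
    using U by (intro mult_mono W small) auto
  also have "\<dots> = 4800 * (U * \<sigma>\<^sup>2) * exp (3 * L - N / 16)"
    using mult_exp_exp[of "2 * L" "L - N / 16"] by (simp add: algebra_simps)
  also have "\<dots> \<le> 4800 * (U * \<sigma>\<^sup>2) * (2048 / N\<^sup>2)"
  proof (intro mult_left_mono)
    have "exp (3 * L - N / 16) \<le> exp (- (N / 32))" using N by (simp add: N_def)
    also have "\<dots> \<le> 2 / (N / 32)\<^sup>2" using Npos by (intro exp_minus_le_inverse_square) simp
    finally show "exp (3 * L - N / 16) \<le> 2048 / N\<^sup>2" by (simp add: power_divide)
  qed (use U in auto)
  also have "\<dots> = 9830400 * Q" by (simp add: Q_def)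
  finally have 23: "(\<sigma> * real K + r)\<^sup>2 * (2 * exp (- (t\<^sup>2 / 32))) ^ n
     + (\<sigma> * real K + r)\<^sup>2 * (real K * exp (- (\<epsilon> / 8 * (real n / 2)))) \<le> 9830400 * Q"
    by (simp add: distrib_left)
  have "10 ^ 7 * Q = 10000000 * Q" by simp
  thus ?thesis using 1 4 23 Q0 unfolding N_def[symmetric] Q_def[symmetric] by linarith
qed

text \<open>The grid of spacing \<open>\<sigma>\<close> that covers \<open>[a, b]\<close> has at most \<open>2 * exp (log_ratio a b \<sigma>)\<close> points. The number
of points and the squared width of the interval are the only places where \<open>log_ratio\<close> enters.\<close>
lemma private_mean_bound_selection:
  assumes \<epsilon>: "0 < \<epsilon>" and \<sigma>: "0 < \<sigma>" and ab: "a < b" and n: "1 \<le> n"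
    and N: "96 * log_ratio a b \<sigma> \<le> real n * \<epsilon>"
  shows "private_mean_bound n \<epsilon> \<sigma> a b
    (\<sigma>\<^sup>2 / real n + 10 ^ 7 * ((ln (real n) + 1 + \<epsilon>) * \<sigma>\<^sup>2 / (real n * \<epsilon>)\<^sup>2))"
proof -
  define L where "L = log_ratio a b \<sigma>"
  define U where "U = ln (real n) + 1 + \<epsilon>"
  define t where "t = 8 * sqrt U"
  define r where "r = (3 * t + 1) * \<sigma>"
  define K where "K = nat \<lfloor>(b - a) / \<sigma>\<rfloor> + 1"
  have L0: "0 \<le> L" by (simp add: L_def log_ratio_def)
  have R0: "0 < (b - a) / \<sigma>" using ab \<sigma> by simp
  have rK: "real K = of_int \<lfloor>(b - a) / \<sigma>\<rfloor> + 1" using R0 by (simp add: K_def)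
  have "(b - a) / \<sigma> \<le> exp L"
    using R0 by (metis L_def exp_le_cancel_iff exp_ln log_ratio_def max.cobounded2)
  moreover have "1 \<le> exp L" using L0 by simp
  moreover have "real K \<le> (b - a) / \<sigma> + 1" unfolding rK by linarith
  ultimately have K: "real K \<le> 2 * exp L" by linarith
  have "(b - a) / \<sigma> < real K" unfolding rK by linarith
  hence bK: "b < a + \<sigma> * real K" using \<sigma> by (simp add: field_simps)
  have "0 \<le> ln (real n)" using n by simp
  hence U1: "1 \<le> U" using \<epsilon> by (simp add: U_def)
  hence t1: "1 \<le> t" using real_sqrt_ge_1_iff[of U] unfolding t_def by linarith
  have r0: "0 < r" unfolding r_def using t1 \<sigma> by (intro mult_pos_pos) auto
  show ?thesis
  proof (rule private_mean_boundI[where K = K and s = "4 * r / (real n * \<epsilon>)" and \<Delta> = "2 * r / real n"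
      and q = "window_count n a \<sigma> t" and f = "clamped_mean n a \<sigma> r" and t = t
      and c\<^sub>1 = "((5 * t + 2) * \<sigma>)\<^sup>2" and c\<^sub>2 = "(\<sigma> * real K + r)\<^sup>2"
      and c\<^sub>3 = "(\<sigma> * real K + r)\<^sup>2 * (real K * exp (- (\<epsilon> / 8 * (real n / 2))))"])
    show "\<sigma>\<^sup>2 / real n + ((5 * t + 2) * \<sigma>)\<^sup>2 * (real n * (2 * exp (- (t\<^sup>2 / 2))))
      + (\<sigma> * real K + r)\<^sup>2 * (2 * exp (- (t\<^sup>2 / 32))) ^ n
      + (\<sigma> * real K + r)\<^sup>2 * (real K * exp (- (\<epsilon> / 8 * (real n / 2)))) + (4 * r / (real n * \<epsilon>))\<^sup>2
      \<le> \<sigma>\<^sup>2 / real n + 10 ^ 7 * ((ln (real n) + 1 + \<epsilon>) * \<sigma>\<^sup>2 / (real n * \<epsilon>)\<^sup>2)"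
      using selection_error_numeric[OF n \<epsilon> \<sigma> L0 _ K] N
      by (simp add: L_def U_def t_def r_def)
    fix x :: "nat \<Rightarrow> real" and \<mu> assume \<mu>: "a \<le> \<mu>" "\<mu> \<le> b"
    show "(\<Sum>g<K. exp_weight K (\<epsilon> / 8) (window_count n a \<sigma> t x) g * (clamped_mean n a \<sigma> r x g - \<mu>)\<^sup>2)
      \<le> ((\<Sum>i<n. x i) / real n - \<mu>)\<^sup>2
        + ((5 * t + 2) * \<sigma>)\<^sup>2 * (\<Sum>i<n. tail_bound \<sigma> \<mu> (t\<^sup>2) t (x i))
        + (\<sigma> * real K + r)\<^sup>2 * (\<Prod>i<n. tail_bound \<sigma> \<mu> (t\<^sup>2 / 16) (t / 4) (x i))
        + (\<sigma> * real K + r)\<^sup>2 * (real K * exp (- (\<epsilon> / 8 * (real n / 2))))"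
      unfolding r_def by (rule selected_clamped_mean_error) (use \<sigma> t1 n \<epsilon> \<mu> bK in auto)
  next
    fix g
    show "(\<lambda>x. window_count n a \<sigma> t x g) \<in> borel_measurable (real_vec n)"
      unfolding window_count_def by measurable
    show "(\<lambda>x. clamped_mean n a \<sigma> r x g) \<in> borel_measurable (real_vec n)"
      unfolding clamped_mean_def by measurable
  qed (use \<epsilon> \<sigma> n r0 window_count_sensitivity clamped_mean_sensitivity in \<open>auto simp: K_def less_imp_le\<close>)
qed

text \<open>On a short interval the main mechanism wastes an additive \<open>\<epsilon>\<close> in \<open>U\<close>. If \<open>\<epsilon>\<close> is at least \<open>48 * ln n\<close>,
selection with a score of range 1 is already reliable among the \<open>O(n)\<close> points of a grid of spacing
\<open>\<sigma> / n\<close>: the probability of failure \<open>O(n) * exp (- (\<epsilon> / 8))\<close> is \<open>O(1 / (n * \<epsilon>)\<^sup>2)\<close>.\<close>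
lemma private_mean_bound_rounding:
  assumes \<epsilon>: "0 < \<epsilon>" and \<sigma>: "0 < \<sigma>" and ab: "a < b" and n: "1 \<le> n"
    and short: "b - a \<le> 3 / 2 * \<sigma>" and large: "48 * ln (real n) \<le> \<epsilon>"
  shows "private_mean_bound n \<epsilon> \<sigma> a b (\<sigma>\<^sup>2 / real n + 10 ^ 5 * (\<sigma>\<^sup>2 / (real n * \<epsilon>)\<^sup>2))"
proof -
  define N where "N = real n * \<epsilon>"
  define h where "h = \<sigma> / real n"
  define K where "K = nat \<lfloor>(b - a) / h\<rfloor> + 1"
  have Npos: "0 < N" using n \<epsilon> by (simp add: N_def)
  have h: "0 < h" using \<sigma> n by (simp add: h_def)
  have hn: "h * real n = \<sigma>" using n by (simp add: h_def)
  have R0: "0 < (b - a) / h" using ab h by simp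
  have rK: "real K = of_int \<lfloor>(b - a) / h\<rfloor> + 1" using R0 by (simp add: K_def)
  have "(b - a) / h < real K" unfolding rK by linarith
  hence bK: "b < a + h * real K" using h by (simp add: field_simps)
  have "real K \<le> (b - a) / h + 1" unfolding rK by linarith
  also have "(b - a) / h \<le> 3 / 2 * \<sigma> / h" using short h by (intro divide_right_mono) auto
  also have "3 / 2 * \<sigma> / h = 3 / 2 * real n" using h by (simp flip: hn)
  finally have K: "real K \<le> 5 / 2 * real n" using n by simp
  have W: "(h * real K + h)\<^sup>2 \<le> 13 * \<sigma>\<^sup>2"
  proof -
    have "h * (real K + 1) \<le> h * (7 / 2 * real n)" using K n h by (intro mult_left_mono) auto
    also have "\<dots> = 7 / 2 * \<sigma>" by (simp flip: hn)
    finally have "(h * (real K + 1))\<^sup>2 \<le> (7 / 2 * \<sigma>)\<^sup>2" using h by (intro power_mono) auto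
    also have "\<dots> \<le> 13 * \<sigma>\<^sup>2" by (simp add: power_mult_distrib power_divide)
    finally show ?thesis by (simp add: distrib_left)
  qed
  have "real n ^ 3 \<le> exp (\<epsilon> / 48) ^ 3"
  proof (intro power_mono)
    have "ln (real n) \<le> \<epsilon> / 48" using large by simp
    thus "real n \<le> exp (\<epsilon> / 48)" using n by (metis exp_le_cancel_iff exp_ln of_nat_0_less_iff zero_less_one order_less_le_trans)
  qed simp
  also have "\<dots> = exp (\<epsilon> / 16)" by (simp flip: exp_of_nat_mult)
  finally have "real n ^ 3 * exp (- (\<epsilon> / 8)) \<le> exp (\<epsilon> / 16) * exp (- (\<epsilon> / 8))" by (intro mult_right_mono) auto
  also have "\<dots> = exp (- (\<epsilon> / 16))" by (simp flip: exp_add)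
  also have "\<dots> \<le> 2 / (\<epsilon> / 16)\<^sup>2" using \<epsilon> by (intro exp_minus_le_inverse_square) simp
  finally have "real n * exp (- (\<epsilon> / 8)) \<le> 512 / N\<^sup>2"
    using \<epsilon> n by (simp add: N_def power_divide field_simps power2_eq_square power3_eq_cube)
  hence "5 / 2 * (real n * exp (- (\<epsilon> / 8))) \<le> 5 / 2 * (512 / N\<^sup>2)" by (intro mult_left_mono) auto
  moreover have "real K * exp (- (\<epsilon> / 8)) \<le> (5 / 2 * real n) * exp (- (\<epsilon> / 8))"
    by (intro mult_right_mono K) auto
  ultimately have E: "real K * exp (- (\<epsilon> / 8)) \<le> 1280 / N\<^sup>2" unfolding mult.assoc by linarith
  have "(h * real K + h)\<^sup>2 * (real K * exp (- (\<epsilon> / 8))) \<le> 13 * \<sigma>\<^sup>2 * (1280 / N\<^sup>2)"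
    using W E by (intro mult_mono) auto
  moreover have "13 * \<sigma>\<^sup>2 * (1280 / N\<^sup>2) = 16640 * (\<sigma>\<^sup>2 / N\<^sup>2)" by simp
  moreover have "(4 * h / \<epsilon>)\<^sup>2 = 16 * (\<sigma>\<^sup>2 / N\<^sup>2)"
    by (simp add: h_def N_def power_divide power_mult_distrib)
  moreover have "0 \<le> \<sigma>\<^sup>2 / N\<^sup>2" by simp
  moreover have "10 ^ 5 * (\<sigma>\<^sup>2 / N\<^sup>2) = 100000 * (\<sigma>\<^sup>2 / N\<^sup>2)" by simp
  ultimately have total: "(h * real K + h)\<^sup>2 * (real K * exp (- (\<epsilon> / 8))) + (4 * h / \<epsilon>)\<^sup>2 \<le> 10 ^ 5 * (\<sigma>\<^sup>2 / N\<^sup>2)"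
    by linarith
  have [measurable]: "truncated_mean n a b \<in> borel_measurable (real_vec n)"
    unfolding truncated_mean_def by measurable
  show ?thesis
  proof (rule private_mean_boundI[where K = K and s = "4 * h / \<epsilon>" and \<Delta> = "2 * h"
      and q = "\<lambda>x g. if \<bar>truncated_mean n a b x - grid a h g\<bar> \<le> h then 1 else 0"
      and f = "\<lambda>x g. clamp_around (grid a h g) h (truncated_mean n a b x)" and t = 0
      and c\<^sub>1 = 0 and c\<^sub>2 = 0
      and c\<^sub>3 = "(h * real K + h)\<^sup>2 * (real K * exp (- (\<epsilon> / 8)))"])
    fix x :: "nat \<Rightarrow> real" and \<mu> assume \<mu>: "a \<le> \<mu>" "\<mu> \<le> b"
    show "(\<Sum>g<K. exp_weight K (\<epsilon> / 8) (\<lambda>g. if \<bar>truncated_mean n a b x - grid a h g\<bar> \<le> h then 1 else 0) g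
           * (clamp_around (grid a h g) h (truncated_mean n a b x) - \<mu>)\<^sup>2)
      \<le> ((\<Sum>i<n. x i) / real n - \<mu>)\<^sup>2 + 0 * (\<Sum>i<n. tail_bound \<sigma> \<mu> (0\<^sup>2) 0 (x i))
        + 0 * (\<Prod>i<n. tail_bound \<sigma> \<mu> (0\<^sup>2 / 16) (0 / 4) (x i)) + (h * real K + h)\<^sup>2 * (real K * exp (- (\<epsilon> / 8)))"
      using selected_truncated_mean_error[OF h _ \<mu> bK, of "\<epsilon> / 8" n x] \<epsilon> by simp
  qed (use \<epsilon> \<sigma> n h total clamp_around_range in \<open>auto simp: K_def N_def less_imp_le\<close>)
qed

text \<open>With one sample and a short interval the data can be ignored. The tiny noise \<open>\<sigma> / 4\<close> only keeps the
algorithm inside the family \<open>gaussian_mixture\<close>, and \<open>(3 / 4)\<^sup>2 + (1 / 4)\<^sup>2 \<le> 1\<close>.\<close>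
lemma private_mean_bound_constant:
  assumes \<epsilon>: "0 < \<epsilon>" and \<sigma>: "0 < \<sigma>" and ab: "a < b" and short: "b - a \<le> 3 / 2 * \<sigma>"
  shows "private_mean_bound 1 \<epsilon> \<sigma> a b (\<sigma>\<^sup>2)"
  unfolding private_mean_bound_def
proof (intro exI conjI allI impI)
  let ?M = "\<lambda>x::nat \<Rightarrow> real. gaussian_mixture 1 (\<epsilon> / 8) (\<sigma> / 4) (\<lambda>_. 0) (\<lambda>_. (a + b) / 2)"
  show "randomized_algorithm 1 ?M"
    using \<sigma> by (intro randomized_algorithm_gaussian_mixture) auto
  show "concentrated_DP 1 (1 / 2 * \<epsilon>\<^sup>2) ?M"
    using \<epsilon> \<sigma> by (intro concentrated_DP_gaussian_mixture[where \<Delta> = 0]) auto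
  fix D :: "real measure" and \<mu> :: real
  assume D: "prob_space D" and \<mu>: "\<mu> \<in> {a..b}"
  interpret P: prob_space "Pi\<^sub>M {..<1::nat} (\<lambda>_. D)" using D by (intro prob_space_PiM)
  have "a \<le> \<mu>" "\<mu> \<le> b" using \<mu> by auto
  moreover have "2 * (b - a) \<le> 3 * \<sigma>" using short by simp
  ultimately have "\<bar>(a + b) / 2 - \<mu>\<bar> \<le> 3 / 4 * \<sigma>" unfolding abs_le_iff by (simp add: field_simps)
  hence "((a + b) / 2 - \<mu>)\<^sup>2 \<le> (3 / 4 * \<sigma>)\<^sup>2" by (rule power2_le_of_abs_le)
  moreover have "(3 / 4 * \<sigma>)\<^sup>2 = 9 / 16 * \<sigma>\<^sup>2" "(\<sigma> / 4)\<^sup>2 = 1 / 16 * \<sigma>\<^sup>2"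
    by (simp_all add: power_mult_distrib power_divide)
  ultimately have "((a + b) / 2 - \<mu>)\<^sup>2 + (\<sigma> / 4)\<^sup>2 \<le> \<sigma>\<^sup>2" using zero_le_power2[of \<sigma>] by linarith
  moreover have "(\<integral>\<^sup>+y. ennreal ((y - \<mu>)\<^sup>2) \<partial>?M x) = ennreal (((a + b) / 2 - \<mu>)\<^sup>2 + (\<sigma> / 4)\<^sup>2)" for x
    using gaussian_mixture_mean_square_error[of 1 "\<sigma> / 4"] sum_exp_weight[of 1] \<sigma> by simp
  ultimately show "(\<integral>\<^sup>+x. (\<integral>\<^sup>+y. ennreal ((y - \<mu>)\<^sup>2) \<partial>?M x) \<partial>(Pi\<^sub>M {..<1} (\<lambda>_. D))) \<le> ennreal (\<sigma>\<^sup>2)"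
    by (simp only: nn_integral_const P.emeasure_space_1 mult_1_right ennreal_leI)
qed

theorem theorem6:
  shows "\<exists>C1>0. \<exists>C2>0. \<forall>(\<epsilon>::real) (\<sigma>::real) (a::real) (b::real) (n::nat).
    \<epsilon> > 0 \<longrightarrow> \<sigma> > 0 \<longrightarrow> a < b \<longrightarrow> n \<ge> 1 \<longrightarrow> real n \<ge> C1 * (log_ratio a b \<sigma> / \<epsilon>) \<longrightarrow>
    (\<exists>M. randomized_algorithm n M \<and> concentrated_DP n (1 / 2 * \<epsilon>\<^sup>2) M \<and>
      (\<forall>(D::real measure) (\<mu>::real).
        prob_space D \<longrightarrow> sets D = sets borel \<longrightarrow> subgaussian \<sigma> D \<longrightarrow>
        (\<integral>x. x \<partial>D) = \<mu> \<longrightarrow> \<mu> \<in> {a..b} \<longrightarrow> symmetric_about D \<mu> \<longrightarrow>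
        (\<integral>\<^sup>+x. (\<integral>\<^sup>+y. ennreal ((y - \<mu>)\<^sup>2) \<partial>M x) \<partial>(Pi\<^sub>M {..<n} (\<lambda>_. D)))
          \<le> ennreal (\<sigma>\<^sup>2 / real n
               + \<sigma>\<^sup>2 / (real n)\<^sup>2 * (C2 * (log_ratio a b \<sigma> / \<epsilon> + ln (real n) / \<epsilon>\<^sup>2)))))"
proof (rule exI[of _ "96::real"], rule conjI, simp, rule exI[of _ "10 ^ 9::real"], rule conjI, simp, intro allI impI)
  fix \<epsilon> \<sigma> a b :: real and n :: nat
  assume \<epsilon>: "0 < \<epsilon>" and \<sigma>: "0 < \<sigma>" and ab: "a < b" and n: "1 \<le> n" and "96 * (log_ratio a b \<sigma> / \<epsilon>) \<le> real n"
  define L where "L = log_ratio a b \<sigma>"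
  define l where "l = ln (real n)"
  have N: "96 * L \<le> real n * \<epsilon>" using \<open>96 * _ \<le> _\<close> \<epsilon> by (simp add: L_def field_simps)
  have L0: "0 \<le> L" by (simp add: L_def log_ratio_def)
  have l0: "0 \<le> l" using n by (simp add: l_def)
  have L\<epsilon>: "0 \<le> L * \<epsilon>" using L0 \<epsilon> by simp
  have l2: "1 / 2 \<le> l" if "n \<noteq> 1"
  proof -
    have "2 \<le> real n" using n that by simp
    hence "ln 2 \<le> l" unfolding l_def by simp
    moreover have "1 / 2 \<le> ln (2::real)" using ln_le_minus_one[of "1 / 2"] by (simp add: ln_div)
    ultimately show ?thesis by linarith
  qed
  let ?v = "\<sigma>\<^sup>2 / real n + \<sigma>\<^sup>2 / (real n)\<^sup>2 * (10 ^ 9 * (L / \<epsilon> + l / \<epsilon>\<^sup>2))"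
  have v: "?v = \<sigma>\<^sup>2 / real n + 10 ^ 9 * ((L * \<epsilon> + l) * \<sigma>\<^sup>2 / (real n * \<epsilon>)\<^sup>2)"
    using \<epsilon> n by (simp add: power_mult_distrib field_simps power2_eq_square)
  have v_ge: "\<sigma>\<^sup>2 / real n + c * (w * \<sigma>\<^sup>2 / (real n * \<epsilon>)\<^sup>2) \<le> ?v" if "c * w \<le> 10 ^ 9 * (L * \<epsilon> + l)" for c w
  proof -
    have "(c * w) * (\<sigma>\<^sup>2 / (real n * \<epsilon>)\<^sup>2) \<le> (10 ^ 9 * (L * \<epsilon> + l)) * (\<sigma>\<^sup>2 / (real n * \<epsilon>)\<^sup>2)"
      using that by (intro mult_right_mono) auto
    thus ?thesis unfolding v mult.assoc times_divide_eq_right[symmetric] by (rule add_left_mono)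
  qed
  have "private_mean_bound n \<epsilon> \<sigma> a b ?v"
  proof (cases "b - a \<le> 3 / 2 * \<sigma>")
    case short: True
    show ?thesis
    proof (cases "n = 1")
      case True
      thus ?thesis
        using private_mean_bound_mono[OF private_mean_bound_constant[OF \<epsilon> \<sigma> ab short]] L0 l0 \<epsilon> by simp
    next
      case False
      show ?thesis
      proof (cases "48 * l \<le> \<epsilon>")
        case True
        have "private_mean_bound n \<epsilon> \<sigma> a b (\<sigma>\<^sup>2 / real n + 10 ^ 5 * (1 * \<sigma>\<^sup>2 / (real n * \<epsilon>)\<^sup>2))"
          using private_mean_bound_rounding[OF \<epsilon> \<sigma> ab n short] True by (simp add: l_def)
        moreover have "10 ^ 5 * 1 \<le> 10 ^ 9 * (L * \<epsilon> + l)"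
          using l2[OF False] L\<epsilon> by simp
        ultimately show ?thesis using private_mean_bound_mono v_ge by blast
      next
        case large: False
        have "10 ^ 7 * (l + 1 + \<epsilon>) \<le> 10 ^ 9 * (L * \<epsilon> + l)"
          using l2[OF False] large L\<epsilon> by simp
        thus ?thesis
          using private_mean_bound_selection[OF \<epsilon> \<sigma> ab n] N private_mean_bound_mono v_ge
          unfolding L_def l_def by blast
      qed
    qed
  next
    case False
    (* The logarithm is bounded below, so that L * \<epsilon> pays for the summand \<epsilon> of U. *)
    have "1 / 3 \<le> L"
    proof -
      have R: "3 / 2 \<le> (b - a) / \<sigma>" using False \<sigma> by (simp add: field_simps)
      have "ln (\<sigma> / (b - a)) \<le> \<sigma> / (b - a) - 1" using ab \<sigma> by (intro ln_le_minus_one) simp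
      moreover have "\<sigma> / (b - a) \<le> 2 / 3" using R ab \<sigma> by (simp add: field_simps)
      moreover have "ln (\<sigma> / (b - a)) = - ln ((b - a) / \<sigma>)" using ab \<sigma> by (simp add: ln_div)
      moreover have "ln ((b - a) / \<sigma>) \<le> L" by (simp add: L_def log_ratio_def)
      ultimately show ?thesis by linarith
    qed
    hence \<epsilon>L: "\<epsilon> \<le> 3 * (L * \<epsilon>)" using \<epsilon> mult_right_mono[of "1 / 3" L \<epsilon>] by simp
    (* The summand 1 of U is paid by ln n; for n = 1 the hypothesis on n forces \<epsilon> to be large. *)
    have "1 \<le> 2 * l + 3 * (L * \<epsilon>)"
    proof (cases "n = 1")
      case True
      hence "1 \<le> \<epsilon>" using N \<open>1 / 3 \<le> L\<close> by simp
      thus ?thesis using \<epsilon>L l0 by linarith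
    next
      case False
      thus ?thesis using l2[OF False] \<epsilon>L \<epsilon> by linarith
    qed
    hence "l + 1 + \<epsilon> \<le> 3 * l + 6 * (L * \<epsilon>)" using \<epsilon>L by linarith
    hence "10000000 * (l + 1 + \<epsilon>) \<le> 10000000 * (3 * l + 6 * (L * \<epsilon>))" by (rule mult_left_mono) simp
    also have "\<dots> \<le> 1000000000 * (L * \<epsilon> + l)" using l0 L\<epsilon> by simp
    finally have "10000000 * (l + 1 + \<epsilon>) \<le> 1000000000 * (L * \<epsilon> + l)" .
    hence "10 ^ 7 * (l + 1 + \<epsilon>) \<le> 10 ^ 9 * (L * \<epsilon> + l)" by simp
    thus ?thesis
      using private_mean_bound_selection[OF \<epsilon> \<sigma> ab n] N private_mean_bound_mono v_ge
      unfolding L_def l_def by blast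
  qed
  thus "\<exists>M. randomized_algorithm n M \<and> concentrated_DP n (1 / 2 * \<epsilon>\<^sup>2) M \<and>
      (\<forall>(D::real measure) (\<mu>::real).
        prob_space D \<longrightarrow> sets D = sets borel \<longrightarrow> subgaussian \<sigma> D \<longrightarrow>
        (\<integral>x. x \<partial>D) = \<mu> \<longrightarrow> \<mu> \<in> {a..b} \<longrightarrow> symmetric_about D \<mu> \<longrightarrow>
        (\<integral>\<^sup>+x. (\<integral>\<^sup>+y. ennreal ((y - \<mu>)\<^sup>2) \<partial>M x) \<partial>(Pi\<^sub>M {..<n} (\<lambda>_. D)))
          \<le> ennreal (\<sigma>\<^sup>2 / real n
               + \<sigma>\<^sup>2 / (real n)\<^sup>2 * (10 ^ 9 * (log_ratio a b \<sigma> / \<epsilon> + ln (real n) / \<epsilon>\<^sup>2))))"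
    unfolding private_mean_bound_def L_def l_def by blast
qed

end
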